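(* Let $N$ be a finite player set, favors be substitutable, and $B^*$ be the cooperation bound. Then: (1) if a network $g$ satisfies $d_i(g)=B^*$ for all $i\in N$, then $g$ is strongly stable; (2) in any strongly stable network, for any positive integer $k<B^*$, there are at most $k+1$ players with exactly $k$ links.
   Context: Networks. $N=\{1,\dots,n\}$ is a finite set of players. A network $g$ is an undirected simple graph on $N$, viewed as its set of links; $N_i(g)=\{j: ij\in g\}$, $d_i(g)=|N_i(g)|$; $g-ij$ is $g$ with link $ij$ deleted. Parameters: $\alpha\in(0,1]$, $p\in(0,1)$, $\delta\in(0,1)$, $v>c>0$, $\gamma\in[0,c)$. Favor exchange game (substitutable favors). Time is $t=0,1,2,\dots$; $g_t$ is the network at the beginning of period $t$, and $g_0=g$ is common knowledge. In each period: (i) players decide, for each of their links, to keep ($K$) or remove ($R$) it (a link removed by either side disappears permanently); (ii) at most one player requires a favor, each given player requiring one with probability $\alpha$; (iii) each other player is independently able to provide the favor in that period with probability $p$; (iv) if some current neighbors of the requester $i$ are able, one of them, $j$, is selected uniformly at random; (v) $j$ chooses $C$ (payoff $v$ to $i$, $-c$ to $j$) or $D$ (payoff $0$ to $i$, $-\gamma$ to $j$). All other payoffs are $0$; discount factor $\delta$. Player $i$ observes with whom she plays, the action profiles in periods in which she plays, and $N_i(g_t)$, but not $g_t$. A strategy $\sigma_i(h_{t,i},j)$ gives, for each private history $h_{t,i}$ and $j\neq i$, a distribution over decisions toward $j$. The bilateral history $h_{t,ij}$ contains only the periods and action profiles of past interactions between $i$ and $j$; $\sigma$ is measurable with respect to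 bilateral histories if $\sigma_i(h_{t,i},j)=\sigma_i(h'_{t,i},j)$ whenever $h_{t,ij}=h'_{t,ij}$. $(g,\sigma)$ is a bilateral equilibrium if $\sigma$ is measurable with respect to bilateral histories and is part of a sequential equilibrium of the game with $g_0=g$. A network $g$ is stable if there is a bilateral equilibrium $(g,\sigma)$ in which on the equilibrium path all favors are provided and all links are kept. Per-period payoff in $g$ when all favors are provided: $u_i(g)=\alpha v\big(1-(1-p)^{d_i(g)}\big)-\sum_{j\in N_i(g)}\alpha c\,\frac{1-(1-p)^{d_j(g)}}{d_j(g)}$. Cooperation bound. $B^*$ is the non-negative integer such that $\delta\alpha v(1-p)^{m-1}p-\delta\alpha c\frac{1-(1-p)^m}{m}\ge(1-\delta)(c-\gamma)$ holds for all positive integers $m\le B^*$ and fails for all $m>B^*$. Sustainability. A link $ij\in g$ is sustainable at $g$ if $\frac{\delta}{1-\delta}\big(u_x(g)-u_x(g-ij)\big)\ge c-\gamma$ for both $x\in\{i,j\}$. Strong stability. $g'$ is obtainable from $g$ via deviations by $\{i,j\}$ if every link in $g'\setminus g$ equals $ij$ and every link in $g\setminus g'$ involves $i$ or $j$. Players $i,j$ violate strong stability at $g$ via $g'$ if $g'$ is obtainable from $g$ via deviations by $\{i,j\}$, $ij\in g'$, $ij\notin g$, $ij$ is sustainable at $g'$, and $u_i(g')\ge u_i(g)$, $u_j(g')\ge u_j(g)$ with at least one inequality strict. A network is strongly stable if it is stable and no pair of players violates strong stability at it (via any $g'$). *)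

theory Defs
  imports "HOL-Probability.Product_PMF"
begin

section \<open>Networks\<close>

text \<open>The players are all elements of a finite type. A network is its set of links, and a link
  is a two-element set of players.\<close>

type_synonym 'a network = "'a set set"

definition network :: "'a network \<Rightarrow> bool" where
  "network g \<longleftrightarrow> (\<forall>e\<in>g. \<exists>i j. i \<noteq> j \<and> e = {i, j})"

definition nbrs :: "'a network \<Rightarrow> 'a \<Rightarrow> 'a set" where
  "nbrs g i = {j. {i, j} \<in> g}"

definition link_degree :: "'a network \<Rightarrow> 'a \<Rightarrow> nat" where
  "link_degree g i = card (nbrs g i)"

record params =
  alpha :: real       \<comment> \<open>probability that a given player requires a favor\<close>
  able_prob :: real   \<comment> \<open>probability \<open>p\<close> of being able to provide it\<close>
  disc :: real        \<comment> \<open>discount factor \<open>\<delta>\<close>\<close>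
  val :: real         \<comment> \<open>value \<open>v\<close> of a received favor\<close>
  cost :: real        \<comment> \<open>cost \<open>c\<close> of providing a favor\<close>
  refuse_cost :: real \<comment> \<open>cost \<open>\<gamma>\<close> of refusing a favor\<close>

definition valid_params :: "params \<Rightarrow> bool" where
  "valid_params P \<longleftrightarrow>
     0 < alpha P \<and> alpha P \<le> 1 \<and>
     0 < able_prob P \<and> able_prob P < 1 \<and>
     0 < disc P \<and> disc P < 1 \<and>
     0 < cost P \<and> cost P < val P \<and>
     0 \<le> refuse_cost P \<and> refuse_cost P < cost P"


section \<open>The favor exchange game\<close>

datatype link_act = Keep | Remove
datatype favor_act = Provide | Refuse

text \<open>In a link profile, the entry at \<open>(i, j)\<close> is the decision of \<open>i\<close> about the link with \<open>j\<close>; it is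
  \<open>None\<close> if \<open>i\<close> and \<open>j\<close> are not linked. A favor \<open>Some (r, s, a)\<close> is requested by \<open>r\<close> from the
  selected neighbor \<open>s\<close>, who chooses \<open>a\<close>; \<open>None\<close> means that no pair plays in that period. The set of
  able players is not recorded: beyond the selected provider, it affects neither payoffs nor
  anyone's observations.\<close>

type_synonym 'a link_profile = "'a \<times> 'a \<Rightarrow> link_act option"
type_synonym 'a favor = "('a \<times> 'a \<times> favor_act) option"
type_synonym 'a period = "'a link_profile \<times> 'a favor"
type_synonym 'a history = "'a period list"

definition kept :: "'a link_profile \<Rightarrow> 'a network" where
  "kept l = {{i, j} | i j. l (i, j) = Some Keep \<and> l (j, i) = Some Keep}"

text \<open>The network \<open>g\<^sub>t\<close> at the beginning of period \<open>t = length h\<close>, given \<open>g\<^sub>0 = g\<close>.\<close>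

definition current_net :: "'a network \<Rightarrow> 'a history \<Rightarrow> 'a network" where
  "current_net g h = (if h = [] then g else kept (fst (last h)))"

text \<open>What \<open>i\<close> observes in a period: for each neighbor \<open>j\<close> the decisions of \<open>i\<close> and \<open>j\<close> about their
  link, and the favor if \<open>i\<close> is the requester or the provider. As \<open>g\<^sub>0\<close> is common knowledge, these
  observations determine the neighbors of \<open>i\<close> at the beginning of each period.\<close>

type_synonym 'a link_obs = "'a \<Rightarrow> link_act option \<times> link_act option"
type_synonym 'a obs = "'a link_obs \<times> 'a favor"

definition link_obs :: "'a \<Rightarrow> 'a link_profile \<Rightarrow> 'a link_obs" where
  "link_obs i l = (\<lambda>j. (l (i, j), l (j, i)))"

definition favor_obs :: "'a \<Rightarrow> 'a favor \<Rightarrow> 'a favor" where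
  "favor_obs i f =
     (case f of None \<Rightarrow> None | Some (r, s, a) \<Rightarrow> if i = r \<or> i = s then f else None)"

definition private_hist :: "'a \<Rightarrow> 'a history \<Rightarrow> 'a obs list" where
  "private_hist i h = map (\<lambda>(l, f). (link_obs i l, favor_obs i f)) h"

text \<open>A behavior strategy of player \<open>i\<close>. At the link stage the arguments are the private history
  \<open>h\<^bsub>t,i\<^esub>\<close> and a player \<open>j\<close>. At the favor stage player \<open>i\<close> has in addition observed the link stage of
  the current period, and \<open>j\<close> is the requester for whom \<open>i\<close> has been selected.\<close>

record 'a strategy =
  link_choice :: "'a obs list \<Rightarrow> 'a \<Rightarrow> link_act pmf"
  favor_choice :: "'a obs list \<Rightarrow> 'a link_obs \<Rightarrow> 'a \<Rightarrow> favor_act pmf"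

type_synonym 'a profile = "'a \<Rightarrow> 'a strategy"

definition link_stage :: "'a profile \<Rightarrow> 'a network \<Rightarrow> 'a history \<Rightarrow> 'a link_profile pmf" where
  "link_stage \<sigma> g h =
     Pi_pmf {(i, j). {i, j} \<in> current_net g h} None
       (\<lambda>(i, j). map_pmf Some (link_choice (\<sigma> i) (private_hist i h) j))"

definition requester :: "params \<Rightarrow> 'a::finite option pmf" where
  "requester P =
     embed_pmf (\<lambda>x. case x of None \<Rightarrow> 1 - real CARD('a) * alpha P | Some i \<Rightarrow> alpha P)"

text \<open>Requester and selected provider, if any, in the network \<open>g\<close> left after the link stage.\<close>

definition match_stage :: "params \<Rightarrow> 'a::finite network \<Rightarrow> ('a \<times> 'a) option pmf" where
  "match_stage P g = do {
     x \<leftarrow> requester P;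
     able \<leftarrow> Pi_pmf UNIV False (\<lambda>_. bernoulli_pmf (able_prob P));
     (case x of
        None \<Rightarrow> return_pmf None
      | Some r \<Rightarrow>
          if \<exists>s\<in>nbrs g r. able s
          then map_pmf (\<lambda>s. Some (r, s)) (pmf_of_set {s\<in>nbrs g r. able s})
          else return_pmf None) }"

definition favor_stage ::
    "'a profile \<Rightarrow> 'a history \<Rightarrow> 'a link_profile \<Rightarrow> ('a \<times> 'a) option \<Rightarrow> 'a favor pmf" where
  "favor_stage \<sigma> h l q =
     (case q of
        None \<Rightarrow> return_pmf None
      | Some (r, s) \<Rightarrow>
          map_pmf (\<lambda>a. Some (r, s, a)) (favor_choice (\<sigma> s) (private_hist s h) (link_obs s l) r))"

definition play_period ::
    "params \<Rightarrow> 'a::finite profile \<Rightarrow> 'a network \<Rightarrow> 'a history \<Rightarrow> 'a period pmf" where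
  "play_period P \<sigma> g h = do {
     l \<leftarrow> link_stage \<sigma> g h;
     q \<leftarrow> match_stage P (kept l);
     f \<leftarrow> favor_stage \<sigma> h l q;
     return_pmf (l, f) }"

text \<open>Distribution of histories \<open>k\<close> periods after \<open>h\<close>, with initial network \<open>g\<close>.\<close>

fun play ::
    "params \<Rightarrow> 'a::finite profile \<Rightarrow> 'a network \<Rightarrow> 'a history \<Rightarrow> nat \<Rightarrow> 'a history pmf" where
  "play P \<sigma> g h 0 = return_pmf h"
| "play P \<sigma> g h (Suc k) = do {
     h' \<leftarrow> play P \<sigma> g h k;
     x \<leftarrow> play_period P \<sigma> g h';
     return_pmf (h' @ [x]) }"

text \<open>Distribution of the nodes at the favor stage of period \<open>t\<close>: history, link profile of
  period \<open>t\<close>, requester and provider.\<close>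

type_synonym 'a favor_node = "'a history \<times> 'a link_profile \<times> ('a \<times> 'a) option"

definition play_to_favor ::
    "params \<Rightarrow> 'a::finite profile \<Rightarrow> 'a network \<Rightarrow> nat \<Rightarrow> 'a favor_node pmf" where
  "play_to_favor P \<sigma> g t = do {
     h \<leftarrow> play P \<sigma> g [] t;
     l \<leftarrow> link_stage \<sigma> g h;
     q \<leftarrow> match_stage P (kept l);
     return_pmf (h, l, q) }"


section \<open>Payoffs\<close>

definition favor_payoff :: "params \<Rightarrow> 'a \<Rightarrow> 'a favor \<Rightarrow> real" where
  "favor_payoff P i f =
     (case f of
        None \<Rightarrow> 0
      | Some (r, s, Provide) \<Rightarrow> if i = r then val P else if i = s then - cost P else 0
      | Some (r, s, Refuse) \<Rightarrow> if i = s then - refuse_cost P else 0)"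

definition link_value ::
    "params \<Rightarrow> 'a::finite network \<Rightarrow> 'a profile \<Rightarrow> 'a \<Rightarrow> 'a history \<Rightarrow> real" where
  "link_value P g \<sigma> i h =
     (\<Sum>k. disc P ^ k *
        measure_pmf.expectation (play P \<sigma> g h (Suc k)) (\<lambda>h'. favor_payoff P i (snd (last h'))))"

fun favor_value ::
    "params \<Rightarrow> 'a::finite network \<Rightarrow> 'a profile \<Rightarrow> 'a \<Rightarrow> 'a favor_node \<Rightarrow> real" where
  "favor_value P g \<sigma> i (h, l, q) =
     measure_pmf.expectation (favor_stage \<sigma> h l q)
       (\<lambda>f. favor_payoff P i f + disc P * link_value P g \<sigma> i (h @ [(l, f)]))"


section \<open>Sequential and bilateral equilibrium\<close>

text \<open>Information sets, as sets of nodes that are reached with positive probability under some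
  strategy profile. They are empty for observations that cannot occur.\<close>

definition link_info ::
    "params \<Rightarrow> 'a::finite network \<Rightarrow> 'a \<Rightarrow> 'a obs list \<Rightarrow> 'a history set" where
  "link_info P g i hi =
     {h. private_hist i h = hi \<and> (\<exists>\<sigma>. h \<in> set_pmf (play P \<sigma> g [] (length hi)))}"

definition favor_info ::
    "params \<Rightarrow> 'a::finite network \<Rightarrow> 'a \<Rightarrow> 'a obs list \<Rightarrow> 'a link_obs \<Rightarrow> 'a \<Rightarrow> 'a favor_node set" where
  "favor_info P g i hi li r =
     {(h, l, q). private_hist i h = hi \<and> link_obs i l = li \<and> q = Some (r, i) \<and>
        (\<exists>\<sigma>. (h, l, q) \<in> set_pmf (play_to_favor P \<sigma> g (length hi)))}"

record 'a beliefs =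
  link_belief :: "'a \<Rightarrow> 'a obs list \<Rightarrow> 'a history pmf"
  favor_belief :: "'a \<Rightarrow> 'a obs list \<Rightarrow> 'a link_obs \<Rightarrow> 'a \<Rightarrow> 'a favor_node pmf"

definition fully_mixed :: "'a profile \<Rightarrow> bool" where
  "fully_mixed \<sigma> \<longleftrightarrow>
     (\<forall>i hi j. set_pmf (link_choice (\<sigma> i) hi j) = UNIV) \<and>
     (\<forall>i hi li j. set_pmf (favor_choice (\<sigma> i) hi li j) = UNIV)"

definition profile_tendsto :: "(nat \<Rightarrow> 'a profile) \<Rightarrow> 'a profile \<Rightarrow> bool" where
  "profile_tendsto \<tau> \<sigma> \<longleftrightarrow>
     (\<forall>i hi j a. (\<lambda>m. pmf (link_choice (\<tau> m i) hi j) a)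
        \<longlonglongrightarrow> pmf (link_choice (\<sigma> i) hi j) a) \<and>
     (\<forall>i hi li j a. (\<lambda>m. pmf (favor_choice (\<tau> m i) hi li j) a)
        \<longlonglongrightarrow> pmf (favor_choice (\<sigma> i) hi li j) a)"

definition consistent ::
    "params \<Rightarrow> 'a::finite network \<Rightarrow> 'a profile \<Rightarrow> 'a beliefs \<Rightarrow> bool" where
  "consistent P g \<sigma> \<mu> \<longleftrightarrow>
     (\<exists>\<tau>. (\<forall>m. fully_mixed (\<tau> m)) \<and> profile_tendsto \<tau> \<sigma> \<and>
       (\<forall>i hi. link_info P g i hi \<noteq> {} \<longrightarrow>
          (\<forall>x. (\<lambda>m. pmf (cond_pmf (play P (\<tau> m) g [] (length hi)) (link_info P g i hi)) x)
             \<longlonglongrightarrow> pmf (link_belief \<mu> i hi) x)) \<and>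
       (\<forall>i hi li r. favor_info P g i hi li r \<noteq> {} \<longrightarrow>
          (\<forall>x. (\<lambda>m. pmf (cond_pmf (play_to_favor P (\<tau> m) g (length hi))
                            (favor_info P g i hi li r)) x)
             \<longlonglongrightarrow> pmf (favor_belief \<mu> i hi li r) x)))"

definition sequentially_rational ::
    "params \<Rightarrow> 'a::finite network \<Rightarrow> 'a profile \<Rightarrow> 'a beliefs \<Rightarrow> bool" where
  "sequentially_rational P g \<sigma> \<mu> \<longleftrightarrow>
     (\<forall>i hi s. link_info P g i hi \<noteq> {} \<longrightarrow>
        measure_pmf.expectation (link_belief \<mu> i hi) (link_value P g (\<sigma>(i := s)) i)
          \<le> measure_pmf.expectation (link_belief \<mu> i hi) (link_value P g \<sigma> i)) \<and>
     (\<forall>i hi li r s. favor_info P g i hi li r \<noteq> {} \<longrightarrow>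
        measure_pmf.expectation (favor_belief \<mu> i hi li r) (favor_value P g (\<sigma>(i := s)) i)
          \<le> measure_pmf.expectation (favor_belief \<mu> i hi li r) (favor_value P g \<sigma> i))"

definition sequential_equilibrium ::
    "params \<Rightarrow> 'a::finite network \<Rightarrow> 'a profile \<Rightarrow> 'a beliefs \<Rightarrow> bool" where
  "sequential_equilibrium P g \<sigma> \<mu> \<longleftrightarrow>
     consistent P g \<sigma> \<mu> \<and> sequentially_rational P g \<sigma> \<mu>"

text \<open>The bilateral history \<open>h\<^bsub>t,ij\<^esub>\<close> is extracted from the private history of \<open>i\<close>. It has one entry
  per period, so that it determines the periods of the interactions between \<open>i\<close> and \<open>j\<close>.\<close>

definition bilateral :: "'a \<Rightarrow> 'a obs list
    \<Rightarrow> ((link_act option \<times> link_act option) \<times> 'a favor) list" where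
  "bilateral j hi = map (\<lambda>(li, f). (li j, favor_obs j f)) hi"

definition bilaterally_measurable :: "'a profile \<Rightarrow> bool" where
  "bilaterally_measurable \<sigma> \<longleftrightarrow>
     (\<forall>i j hi hi'. i \<noteq> j \<longrightarrow> bilateral j hi = bilateral j hi' \<longrightarrow>
        link_choice (\<sigma> i) hi j = link_choice (\<sigma> i) hi' j) \<and>
     (\<forall>i j hi hi' li li'. i \<noteq> j \<longrightarrow> bilateral j hi = bilateral j hi' \<longrightarrow> li j = li' j \<longrightarrow>
        favor_choice (\<sigma> i) hi li j = favor_choice (\<sigma> i) hi' li' j)"

definition bilateral_equilibrium ::
    "params \<Rightarrow> 'a::finite network \<Rightarrow> 'a profile \<Rightarrow> bool" where
  "bilateral_equilibrium P g \<sigma> \<longleftrightarrow>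
     bilaterally_measurable \<sigma> \<and> (\<exists>\<mu>. sequential_equilibrium P g \<sigma> \<mu>)"

definition cooperative_path :: "params \<Rightarrow> 'a::finite network \<Rightarrow> 'a profile \<Rightarrow> bool" where
  "cooperative_path P g \<sigma> \<longleftrightarrow>
     (\<forall>t. \<forall>h\<in>set_pmf (play P \<sigma> g [] t). \<forall>(l, f)\<in>set h.
        (\<forall>i j. l (i, j) \<noteq> Some Remove) \<and> (\<forall>r s. f \<noteq> Some (r, s, Refuse)))"

definition stable :: "params \<Rightarrow> 'a::finite network \<Rightarrow> bool" where
  "stable P g \<longleftrightarrow> (\<exists>\<sigma>. bilateral_equilibrium P g \<sigma> \<and> cooperative_path P g \<sigma>)"


section \<open>Cooperation bound and strong stability\<close>

definition net_payoff :: "params \<Rightarrow> 'a network \<Rightarrow> 'a \<Rightarrow> real" where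
  "net_payoff P g i =
     alpha P * val P * (1 - (1 - able_prob P) ^ link_degree g i)
     - (\<Sum>j\<in>nbrs g i. alpha P * cost P *
          ((1 - (1 - able_prob P) ^ link_degree g j) / real (link_degree g j)))"

definition cooperation_bound :: "params \<Rightarrow> nat \<Rightarrow> bool" where
  "cooperation_bound P B \<longleftrightarrow>
     (\<forall>m>0.
        disc P * alpha P * val P * (1 - able_prob P) ^ (m - 1) * able_prob P
          - disc P * alpha P * cost P * ((1 - (1 - able_prob P) ^ m) / real m)
          \<ge> (1 - disc P) * (cost P - refuse_cost P)
        \<longleftrightarrow> m \<le> B)"

definition sustainable :: "params \<Rightarrow> 'a network \<Rightarrow> 'a \<Rightarrow> 'a \<Rightarrow> bool" where
  "sustainable P g i j \<longleftrightarrow>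
     {i, j} \<in> g \<and>
     (\<forall>x\<in>{i, j}. disc P / (1 - disc P) * (net_payoff P g x - net_payoff P (g - {{i, j}}) x)
        \<ge> cost P - refuse_cost P)"

definition obtainable :: "'a network \<Rightarrow> 'a network \<Rightarrow> 'a \<Rightarrow> 'a \<Rightarrow> bool" where
  "obtainable g g' i j \<longleftrightarrow>
     network g' \<and> (\<forall>e\<in>g' - g. e = {i, j}) \<and> (\<forall>e\<in>g - g'. i \<in> e \<or> j \<in> e)"

definition violate_strong_stability ::
    "params \<Rightarrow> 'a network \<Rightarrow> 'a network \<Rightarrow> 'a \<Rightarrow> 'a \<Rightarrow> bool" where
  "violate_strong_stability P g g' i j \<longleftrightarrow>
     obtainable g g' i j \<and> {i, j} \<in> g' \<and> {i, j} \<notin> g \<and> sustainable P g' i j \<and>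
     net_payoff P g' i \<ge> net_payoff P g i \<and> net_payoff P g' j \<ge> net_payoff P g j \<and>
     (net_payoff P g' i > net_payoff P g i \<or> net_payoff P g' j > net_payoff P g j)"

definition strongly_stable :: "params \<Rightarrow> 'a::finite network \<Rightarrow> bool" where
  "strongly_stable P g \<longleftrightarrow>
     network g \<and> stable P g \<and> \<not> (\<exists>i j g'. violate_strong_stability P g g' i j)"

end

theory Submission
  imports Defs
begin

text \<open>Adding a link \<open>ij\<close> to a network raises the payoff of \<open>i\<close> by
  \<open>\<alpha> v q\<^bsup>m-1\<^esup> p - \<alpha> c (1 - q\<^sup>n) / n\<close>, where \<open>q = 1 - p\<close> and \<open>m\<close>, \<open>n\<close> are the new degrees of \<open>i\<close>
  and \<open>j\<close>. Hence two players of equal degree below \<open>B\<close> gain from a link between them and can sustain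
  it, so that in a strongly stable network the players of degree \<open>k < B\<close> form a clique. In a
  \<open>B\<close>-regular network a new link is sustainable only if both ends drop another link, and then, as
  \<open>(1 - q\<^sup>n) / n\<close> decreases in \<open>n\<close>, they are no better off.

  Stability of a \<open>B\<close>-regular network is witnessed by grim trigger on each link separately: a refused
  favor is answered by removing the link and by refusing favors on it. Perturb all
  choices by errors of the same order. What \<open>i\<close> observes can always be explained without errors
  between other players, hence in the limit \<open>i\<close> is certain that all links between others are intact.
  Under this belief the lifetime payoff of \<open>i\<close> with as many neighbors as she has unsoiled links is a
  potential: it is conserved under grim trigger, and no deviation of \<open>i\<close> can raise it, as losing a
  link costs at least \<open>(c - \<gamma>) / \<delta>\<close>.\<close>

section \<open>Payoffs and degrees\<close>

text \<open>The sum \<open>1 + q + ... + q ^ (m - 1)\<close> has \<open>m\<close> terms, each at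
  least \<open>q ^ m\<close>. This inequality is what makes \<open>ask_prob\<close>
  decreasing.\<close>

lemma power_le_one_minus_power:
  fixes q :: real
  assumes "0 \<le> q" "q \<le> 1"
  shows "real m * q ^ m * (1 - q) \<le> 1 - q ^ m"
proof -
  have "real m * q ^ m \<le> (\<Sum>i<m. q ^ i)"
    using sum_mono[of "{..<m}" "\<lambda>_. q ^ m" "\<lambda>i. q ^ i"] assms
    by (simp add: power_decreasing)
  then have "real m * q ^ m * (1 - q) \<le> (\<Sum>i<m. q ^ i) * (1 - q)"
    using assms by (intro mult_right_mono) auto
  also have "\<dots> = 1 - q ^ m"
    by (simp add: one_diff_power_eq mult.commute)
  finally show ?thesis .
qed

text \<open>Probability that a requester with \<open>m\<close> neighbors, each unable with
  probability \<open>q\<close>, turns to a given one of them: by symmetry they share equally the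
  probability that someone is able. Division by zero makes it \<open>0\<close> at
  \<open>m = 0\<close>.\<close>

definition ask_prob :: "real \<Rightarrow> nat \<Rightarrow> real" where
  "ask_prob q m = (1 - q ^ m) / real m"

text \<open>Cleared of denominators, the step from \<open>n\<close> to \<open>n + 1\<close> reads
  \<open>n * q ^ n * (1 - q) \<le> 1 - q ^ n\<close>, which is the preceding inequality.\<close>

lemma ask_prob_antimono:
  assumes "0 \<le> q" "q \<le> 1" "0 < m" "m \<le> n"
  shows "ask_prob q n \<le> ask_prob q m"
  using assms(4)
proof (induction n rule: dec_induct)
  case (step n)
  have "real n * (1 - q ^ Suc n) \<le> real (Suc n) * (1 - q ^ n)"
    using power_le_one_minus_power[of q n] assms by (simp add: algebra_simps)
  then have "ask_prob q (Suc n) \<le> ask_prob q n"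
    using step assms unfolding ask_prob_def by (simp add: field_simps)
  then show ?case using step by simp
qed simp

section \<open>Degrees and the marginal payoff of a link\<close>

lemma nbrs_sym: "j \<in> nbrs g i \<longleftrightarrow> i \<in> nbrs g j"
  unfolding nbrs_def by (simp add: insert_commute)

lemma network_no_loop: "network g \<Longrightarrow> {i} \<notin> g"
  unfolding network_def by (metis insert_absorb2 doubleton_eq_iff)

lemma not_in_own_nbrs: "network g \<Longrightarrow> i \<notin> nbrs g i"
  unfolding nbrs_def by (simp add: network_no_loop)

lemma link_degree_pos: "{i, j} \<in> g \<Longrightarrow> 0 < link_degree g (i :: 'a :: finite)"
  unfolding link_degree_def nbrs_def by (auto simp: card_gt_0_iff)

lemma nbrs_delete_link: "nbrs (g - {{i, j}}) i = nbrs g i - {j}"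
  unfolding nbrs_def by (auto simp: doubleton_eq_iff)

lemma nbrs_delete_other: "k \<noteq> i \<Longrightarrow> k \<noteq> j \<Longrightarrow> nbrs (g - {{i, j}}) k = nbrs g k"
  unfolding nbrs_def by (auto simp: doubleton_eq_iff)

lemma net_payoff_ask_prob:
  "net_payoff P g i = alpha P * val P * (1 - (1 - able_prob P) ^ link_degree g i)
     - (\<Sum>j\<in>nbrs g i. alpha P * cost P * ask_prob (1 - able_prob P) (link_degree g j))"
  unfolding net_payoff_def ask_prob_def ..

text \<open>The deleted link touches only \<open>i\<close> and \<open>j\<close>, so the other
  neighbors of \<open>i\<close> keep their degrees and ask \<open>i\<close> as often as before. Only
  the degree of \<open>i\<close> and the cost term of \<open>j\<close> change.\<close>

lemma net_payoff_delete_link: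
  fixes g :: "'a :: finite network"
  assumes "network g" "{i, j} \<in> g"
  shows "net_payoff P g i - net_payoff P (g - {{i, j}}) i
    = alpha P * val P * (1 - able_prob P) ^ (link_degree g i - 1) * able_prob P
      - alpha P * cost P * ask_prob (1 - able_prob P) (link_degree g j)"
proof -
  define q where "q = 1 - able_prob P"
  let ?g = "g - {{i, j}}"
  have ij: "i \<noteq> j" using assms by (metis insert_absorb2 network_no_loop)
  have j: "j \<in> nbrs g i" using assms by (simp add: nbrs_def)
  obtain m where m: "link_degree g i = Suc m"
    using link_degree_pos[OF assms(2)] by (cases "link_degree g i") auto
  then have m': "link_degree ?g i = m"
    using j unfolding link_degree_def nbrs_delete_link by simp
  have "link_degree ?g k = link_degree g k" if "k \<in> nbrs g i - {j}" for k
    using that not_in_own_nbrs[OF assms(1)]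
    by (metis DiffE insertI1 link_degree_def nbrs_delete_other)
  then have "(\<Sum>k\<in>nbrs ?g i. alpha P * cost P * ask_prob q (link_degree ?g k))
    = (\<Sum>k\<in>nbrs g i - {j}. alpha P * cost P * ask_prob q (link_degree g k))"
    unfolding nbrs_delete_link by (intro sum.cong) auto
  moreover have "(\<Sum>k\<in>nbrs g i. alpha P * cost P * ask_prob q (link_degree g k))
    = alpha P * cost P * ask_prob q (link_degree g j)
      + (\<Sum>k\<in>nbrs g i - {j}. alpha P * cost P * ask_prob q (link_degree g k))"
    using j by (intro sum.remove) auto
  ultimately show ?thesis
    unfolding net_payoff_ask_prob m m' q_def[symmetric]
    by (simp add: algebra_simps) (simp add: q_def algebra_simps)
qed

text \<open>The sustainability inequality for an end of degree \<open>m\<close> whose partner has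
  degree \<open>n\<close>, both counting the link, multiplied by \<open>1 - disc P\<close>. For
  \<open>m = n\<close> it is the inequality of the cooperation bound; separating the two degrees
  lets each vary on its own.\<close>

definition worth :: "params \<Rightarrow> nat \<Rightarrow> nat \<Rightarrow> bool" where
  "worth P m n \<longleftrightarrow>
     disc P * (alpha P * val P * (1 - able_prob P) ^ (m - 1) * able_prob P
        - alpha P * cost P * ask_prob (1 - able_prob P) n)
     \<ge> (1 - disc P) * (cost P - refuse_cost P)"

lemma sustainable_iff_worth:
  fixes g :: "'a :: finite network"
  assumes "valid_params P" "network g" "{i, j} \<in> g"
  shows "sustainable P g i j \<longleftrightarrow>
    worth P (link_degree g i) (link_degree g j) \<and> worth P (link_degree g j) (link_degree g i)"
proof -
  have "disc P < 1" using assms by (simp add: valid_params_def)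
  then have *: "b \<le> disc P * a / (1 - disc P) \<longleftrightarrow> (1 - disc P) * b \<le> disc P * a" for a b
    by (simp add: field_simps)
  have ji: "{j, i} = {i, j}" by auto
  show ?thesis
    using assms(3) net_payoff_delete_link[OF assms(2), of i j P]
      net_payoff_delete_link[OF assms(2), of j i P]
    unfolding sustainable_def worth_def ji by (simp add: *)
qed

lemma cooperation_bound_worth:
  assumes "cooperation_bound P B" "0 < m"
  shows "worth P m m \<longleftrightarrow> m \<le> B"
  using assms unfolding cooperation_bound_def worth_def ask_prob_def
  by (simp add: algebra_simps)

text \<open>With fewer links of one's own, each is a less redundant source of favors; a partner with
  more links asks less often. The partner's degree must start above \<open>0\<close>, where
  \<open>ask_prob\<close> has its default value.\<close>

lemma worth_mono:
  assumes "valid_params P" "worth P m n" "m' \<le> m" "n \<le> n'" "0 < n"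
  shows "worth P m' n'"
proof -
  have v: "0 < disc P" "0 < alpha P" "0 < val P" "0 < cost P" "0 < able_prob P" "able_prob P < 1"
    using assms by (auto simp: valid_params_def)
  have "alpha P * val P * (1 - able_prob P) ^ (m - 1) * able_prob P
      - alpha P * cost P * ask_prob (1 - able_prob P) n
    \<le> alpha P * val P * (1 - able_prob P) ^ (m' - 1) * able_prob P
      - alpha P * cost P * ask_prob (1 - able_prob P) n'"
    using v assms
    by (intro diff_mono mult_left_mono mult_right_mono power_decreasing ask_prob_antimono) auto
  then show ?thesis
    using assms(2) v unfolding worth_def
    by (meson mult_left_mono less_imp_le order_trans)
qed

section \<open>Players of equal degree below the bound\<close>

lemma network_insert: "network g \<Longrightarrow> i \<noteq> j \<Longrightarrow> network (insert {i, j} g)"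
  unfolding network_def by auto

lemma link_degree_insert:
  fixes g :: "'a :: finite network"
  assumes "{i, j} \<notin> g"
  shows "link_degree (insert {i, j} g) i = Suc (link_degree g i)"
proof -
  have "nbrs (insert {i, j} g) i = insert j (nbrs g i)"
    unfolding nbrs_def by (auto simp: doubleton_eq_iff)
  moreover have "j \<notin> nbrs g i" using assms by (simp add: nbrs_def)
  ultimately show ?thesis by (simp add: link_degree_def)
qed

text \<open>The right-hand side of \<open>worth\<close> is positive as \<gamma> < c. This gives the
  strict inequality that a violation of strong stability asks for.\<close>

lemma worth_imp_gain:
  assumes "valid_params P" "worth P m n"
  shows "alpha P * val P * (1 - able_prob P) ^ (m - 1) * able_prob P
      - alpha P * cost P * ask_prob (1 - able_prob P) n > 0"
proof -
  have "0 < (1 - disc P) * (cost P - refuse_cost P)" "0 < disc P"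
    using assms by (auto simp: valid_params_def)
  then show ?thesis
    using assms(2) unfolding worth_def by (metis less_le_trans zero_less_mult_pos)
qed

text \<open>Adding the link and dropping none gives both ends degree \<open>k + 1 \<le> B\<close>,
  so the single inequality \<open>worth P (Suc k) (Suc k)\<close> yields the gain and the
  sustainability for both.\<close>

lemma violation_of_equal_degrees:
  fixes g :: "'a :: finite network"
  assumes "valid_params P" "cooperation_bound P B" "network g"
    and "i \<noteq> j" "{i, j} \<notin> g" "link_degree g i = k" "link_degree g j = k" "k < B"
  shows "violate_strong_stability P g (insert {i, j} g) i j"
proof -
  let ?g = "insert {i, j} g"
  have ji: "{j, i} = {i, j}" by auto
  have net: "network ?g" using assms by (simp add: network_insert)
  have deg: "link_degree ?g i = Suc k" "link_degree ?g j = Suc k"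
    using assms link_degree_insert[of i j g] link_degree_insert[of j i g] by (simp_all add: ji)
  have w: "worth P (Suc k) (Suc k)"
    using assms by (simp add: cooperation_bound_worth)
  have del: "?g - {{i, j}} = g" using assms by auto
  have "net_payoff P ?g i > net_payoff P g i" "net_payoff P ?g j > net_payoff P g j"
    using worth_imp_gain[OF assms(1) w] net_payoff_delete_link[OF net, of i j P]
      net_payoff_delete_link[OF net, of j i P] unfolding ji del deg by auto
  moreover have "sustainable P ?g i j"
    using sustainable_iff_worth[OF assms(1) net, of i j] deg w by simp
  ultimately show ?thesis
    using net assms by (auto simp: violate_strong_stability_def obtainable_def)
qed

text \<open>Two players of degree \<open>k\<close> must be linked, so all of them lie in the closed
  neighborhood of any one of them, which has \<open>k + 1\<close> elements.\<close>

lemma strongly_stable_degree_count: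
  fixes g :: "'a :: finite network"
  assumes "valid_params P" "cooperation_bound P B" "strongly_stable P g" "k < B"
  shows "card {i. link_degree g i = k} \<le> k + 1"
proof (rule ccontr)
  let ?S = "{i. link_degree g i = k}"
  assume c: "\<not> card ?S \<le> k + 1"
  then obtain i where i: "link_degree g i = k"
    by (metis (mono_tags, lifting) card.empty empty_Collect_eq le0)
  have "card (insert i (nbrs g i)) \<le> k + 1"
    using i by (simp add: link_degree_def card_insert_if)
  then have "\<not> ?S \<subseteq> insert i (nbrs g i)"
    using c card_mono[of "insert i (nbrs g i)" ?S] by fastforce
  then obtain j where "link_degree g j = k" "j \<noteq> i" "{i, j} \<notin> g"
    by (auto simp: nbrs_def)
  then show False
    using violation_of_equal_degrees[OF assms(1,2), of g i j k] assms i
    by (auto simp: strongly_stable_def)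
qed

section \<open>Regular networks admit no violation\<close>

text \<open>Per-period payoff of a player with \<open>m\<close> neighbors, each of whom has degree
  \<open>B\<close>.\<close>

definition regular_payoff :: "params \<Rightarrow> nat \<Rightarrow> nat \<Rightarrow> real" where
  "regular_payoff P B m = alpha P * val P * (1 - (1 - able_prob P) ^ m)
     - real m * (alpha P * cost P * ask_prob (1 - able_prob P) B)"

lemma regular_payoff_Suc:
  "regular_payoff P B (Suc m) - regular_payoff P B m
    = alpha P * val P * (1 - able_prob P) ^ m * able_prob P
      - alpha P * cost P * ask_prob (1 - able_prob P) B"
  unfolding regular_payoff_def by (simp add: algebra_simps)

text \<open>The inequality at the bound, \<open>worth P B B\<close>, passes to every smaller own
  degree while the partner's degree stays \<open>B\<close>.\<close>

lemma regular_payoff_Suc_gain: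
  assumes "valid_params P" "cooperation_bound P B" "m < B"
  shows "disc P * (regular_payoff P B (Suc m) - regular_payoff P B m)
    \<ge> (1 - disc P) * (cost P - refuse_cost P)"
proof -
  have "worth P (Suc m) B"
    using worth_mono[OF assms(1), of B B "Suc m" B] assms cooperation_bound_worth[of P B B] by simp
  then show ?thesis unfolding regular_payoff_Suc worth_def by simp
qed

lemma regular_payoff_mono:
  assumes "valid_params P" "cooperation_bound P B" "m \<le> n" "n \<le> B"
  shows "regular_payoff P B m \<le> regular_payoff P B n"
  using assms(3,4)
proof (induction n rule: dec_induct)
  case (step n)
  have "0 < (1 - disc P) * (cost P - refuse_cost P)" "0 < disc P"
    using assms by (auto simp: valid_params_def)
  then have "0 < regular_payoff P B (Suc n) - regular_payoff P B n"
    using regular_payoff_Suc_gain[OF assms(1,2), of n] step.prems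
    by (metis Suc_le_eq less_le_trans zero_less_mult_pos)
  then show ?case using step by simp
qed simp

text \<open>Sustainability caps the degrees of both ends at \<open>B\<close>, so no degree in
  \<open>g'\<close> exceeds \<open>B\<close>. Then every neighbor asks at least as often as one of
  degree \<open>B\<close> would, and nobody earns more than in \<open>g\<close>.\<close>

lemma regular_net_no_violation:
  fixes g :: "'a :: finite network"
  assumes "valid_params P" "cooperation_bound P B" "network g" "\<And>i. link_degree g i = B"
  shows "\<not> violate_strong_stability P g g' i j"
proof
  assume viol: "violate_strong_stability P g g' i j"
  then have net: "network g'" and new: "\<And>e. e \<in> g' \<Longrightarrow> e \<notin> g \<Longrightarrow> e = {i, j}"
    and ij: "{i, j} \<in> g'" and sus: "sustainable P g' i j"
    by (auto simp: violate_strong_stability_def obtainable_def)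
  have v: "0 < alpha P" "0 < cost P" "0 < able_prob P" "able_prob P < 1"
    using assms by (auto simp: valid_params_def)
  have i_ne_j: "i \<noteq> j" using ij net by (metis insert_absorb2 network_no_loop)
  have sub: "nbrs g' x \<subseteq> insert y (nbrs g x)" if "{x, y} = {i, j}" for x y
    using new that by (force simp: nbrs_def doubleton_eq_iff)
  have sub': "nbrs g' x \<subseteq> nbrs g x" if "x \<noteq> i" "x \<noteq> j" for x
    using new that by (force simp: nbrs_def doubleton_eq_iff)
  have le_Suc: "link_degree g' x \<le> Suc B" for x
  proof -
    \<comment> \<open>An end of the new link can gain only the other end as a neighbor; anyone else
      gains nobody, and then any \<open>y\<close> will do.\<close>
    obtain y where "nbrs g' x \<subseteq> insert y (nbrs g x)"
      by (metis insert_commute sub sub' subset_insertI2)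
    then have "card (nbrs g' x) \<le> card (insert y (nbrs g x))" by (intro card_mono) auto
    also have "\<dots> \<le> Suc B" using assms(4)[of x] by (simp add: link_degree_def card_insert_if)
    finally show ?thesis by (simp add: link_degree_def)
  qed
  have le_B: "link_degree g' x \<le> B" if xy: "{x, y} = {i, j}" for x y
  proof (rule ccontr)
    assume "\<not> link_degree g' x \<le> B"
    then have "link_degree g' x = Suc B" using le_Suc[of x] by simp
    moreover have "worth P (link_degree g' x) (link_degree g' y)"
      using sustainable_iff_worth[OF assms(1) net ij] sus xy by (auto simp: doubleton_eq_iff)
    moreover have "0 < link_degree g' y"
      using ij xy link_degree_pos[of y x g'] by (simp add: insert_commute)
    \<comment> \<open>The other end has degree at most \<open>B + 1\<close>; raising that degree to
      \<open>B + 1\<close> preserves \<open>worth\<close>, which contradicts the bound.\<close>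
    ultimately have "worth P (Suc B) (Suc B)"
      using worth_mono[OF assms(1), of "Suc B" "link_degree g' y" "Suc B" "Suc B"] le_Suc by simp
    then show False using cooperation_bound_worth[OF assms(2), of "Suc B"] by simp
  qed
  have ji: "{j, i} = {i, j}" by auto
  have all_le_B: "link_degree g' x \<le> B" for x
  proof (cases "x = i \<or> x = j")
    case True then show ?thesis using le_B[of i j] le_B[of j i] ji by auto
  next
    case False
    then have "card (nbrs g' x) \<le> card (nbrs g x)" using sub' by (intro card_mono) auto
    then show ?thesis using assms(4)[of x] by (simp add: link_degree_def)
  qed
  have upper: "net_payoff P g' x \<le> regular_payoff P B B" for x
  proof -
    have "(\<Sum>k\<in>nbrs g' x. alpha P * cost P * ask_prob (1 - able_prob P) B)
      \<le> (\<Sum>k\<in>nbrs g' x. alpha P * cost P * ask_prob (1 - able_prob P) (link_degree g' k))"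
    proof (rule sum_mono)
      fix k assume "k \<in> nbrs g' x"
      then have "0 < link_degree g' k"
        using link_degree_pos[of k x g'] by (simp add: nbrs_def insert_commute)
      then show "alpha P * cost P * ask_prob (1 - able_prob P) B
        \<le> alpha P * cost P * ask_prob (1 - able_prob P) (link_degree g' k)"
        using v all_le_B by (intro mult_left_mono ask_prob_antimono) auto
    qed
    then have "net_payoff P g' x \<le> regular_payoff P B (link_degree g' x)"
      unfolding net_payoff_ask_prob regular_payoff_def by (simp add: link_degree_def)
    also have "\<dots> \<le> regular_payoff P B B"
      using regular_payoff_mono[OF assms(1,2)] all_le_B by blast
    finally show ?thesis .
  qed
  have "net_payoff P g x = regular_payoff P B B" for x
    using assms(4) unfolding net_payoff_ask_prob regular_payoff_def
    by (simp add: link_degree_def)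
  then show False
    using viol upper[of i] upper[of j] by (auto simp: violate_strong_stability_def)
qed


section \<open>Matching\<close>

lemma expectation_bind_finite:
  fixes h :: "'b \<Rightarrow> real"
  assumes "finite (set_pmf p)" "\<And>x. x \<in> set_pmf p \<Longrightarrow> finite (set_pmf (f x))"
  shows "measure_pmf.expectation (p \<bind> f) h
    = measure_pmf.expectation p (\<lambda>x. measure_pmf.expectation (f x) h)"
  using assms
  by (simp add: pmf_expectation_bind[of "set_pmf p"] integral_measure_pmf[of "set_pmf p" p])

context
  fixes P :: params
  assumes valid: "valid_params P" and few: "real CARD('a::finite) * alpha P \<le> 1"
begin

text \<open>The assumption \<open>few\<close> makes the weight of \<open>None\<close> nonnegative,
  so that \<open>embed_pmf\<close> is applied to a genuine distribution.\<close>

lemma pmf_requester: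
  "pmf (requester P) (x :: 'a option)
    = (case x of None \<Rightarrow> 1 - real CARD('a) * alpha P | Some i \<Rightarrow> alpha P)"
  unfolding requester_def
proof (rule pmf_embed_pmf)
  have a: "0 < alpha P" using valid by (simp add: valid_params_def)
  show "0 \<le> (case x of None \<Rightarrow> 1 - real CARD('a) * alpha P | Some i \<Rightarrow> alpha P)"
    for x :: "'a option"
    using few a by (cases x) auto
  then have "(\<integral>\<^sup>+ x. ennreal (case x of None \<Rightarrow> 1 - real CARD('a) * alpha P
      | Some (i :: 'a) \<Rightarrow> alpha P) \<partial>count_space UNIV)
    = ennreal (\<Sum>x\<in>UNIV. case x of None \<Rightarrow> 1 - real CARD('a) * alpha P
      | Some (i :: 'a) \<Rightarrow> alpha P)"
    by (simp add: nn_integral_count_space_finite sum_ennreal)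
  also have "\<dots> = 1"
    by (simp add: UNIV_option_conv sum.reindex)
  finally show "(\<integral>\<^sup>+ x. ennreal (case x of None \<Rightarrow> 1 - real CARD('a) * alpha P
      | Some (i :: 'a) \<Rightarrow> alpha P) \<partial>count_space UNIV) = 1" .
qed

definition able_pmf :: "('a \<Rightarrow> bool) pmf" where
  "able_pmf = Pi_pmf UNIV False (\<lambda>_. bernoulli_pmf (able_prob P))"

lemma prob_none_able:
  "measure_pmf.prob able_pmf {able. \<forall>s\<in>N. \<not> able s} = (1 - able_prob P) ^ card N"
proof -
  have p: "0 < able_prob P" "able_prob P < 1" using valid by (auto simp: valid_params_def)
  have "{able. \<forall>s\<in>N. \<not> able s} = Pi UNIV (\<lambda>s. if s \<in> N then {False} else UNIV)"
    by (auto simp: Pi_def split: if_splits)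
  then have "measure_pmf.prob able_pmf {able. \<forall>s\<in>N. \<not> able s}
    = (\<Prod>s\<in>UNIV. measure_pmf.prob (bernoulli_pmf (able_prob P)) (if s \<in> N then {False} else UNIV))"
    unfolding able_pmf_def by (simp add: measure_Pi_pmf_Pi)
  also have "\<dots> = (\<Prod>s\<in>UNIV. if s \<in> N then 1 - able_prob P else 1)"
    using p by (intro prod.cong) (auto simp: measure_pmf_single)
  also have "\<dots> = (1 - able_prob P) ^ card N"
    by (simp add: prod.If_cases)
  finally show ?thesis .
qed

text \<open>Conditional probability, given who is able, that a requester with neighborhood
  \<open>N\<close> is served by \<open>s\<close>.\<close>

definition share :: "'a set \<Rightarrow> 'a \<Rightarrow> ('a \<Rightarrow> bool) \<Rightarrow> real" where
  "share N s able = (if s \<in> N \<and> able s then 1 / real (card {s\<in>N. able s}) else 0)"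

text \<open>Exchanging \<open>s\<close> and \<open>s'\<close> preserves \<open>N\<close> and the law
  of the independent, identically distributed abilities, and turns one share into the other.\<close>

lemma expectation_share_eq:
  assumes "s \<in> N" "s' \<in> N"
  shows "measure_pmf.expectation able_pmf (share N s) = measure_pmf.expectation able_pmf (share N s')"
proof -
  define h where "h = Transposition.transpose s s'"
  have h: "bij h" unfolding h_def by (rule bij_transpose)
  have hh: "h (h x) = x" for x unfolding h_def by (simp add: transpose_involutory)
  have hN: "h x \<in> N \<longleftrightarrow> x \<in> N" for x
    using assms unfolding h_def Transposition.transpose_def by auto
  have "share N s (able \<circ> h) = share N s' able" for able
  proof -
    have "bij_betw h {x\<in>N. able (h x)} {x\<in>N. able x}"
      by (rule bij_betw_byWitness[of _ h]) (auto simp: hh hN)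
    then have "card {x\<in>N. able (h x)} = card {x\<in>N. able x}" by (rule bij_betw_same_card)
    then show ?thesis using assms unfolding share_def by (simp add: h_def)
  qed
  moreover have "able_pmf = map_pmf (\<lambda>able. able \<circ> h) able_pmf"
    unfolding able_pmf_def using h by (intro Pi_pmf_bij_betw) auto
  ultimately show ?thesis
    using integral_map_pmf[of "\<lambda>able. able \<circ> h" able_pmf "share N s"] by simp
qed

text \<open>The shares of all members of \<open>N\<close> add up to \<open>1\<close> unless nobody
  in \<open>N\<close> is able; by symmetry each has the same expectation.\<close>

lemma expectation_share:
  assumes "s \<in> N"
  shows "measure_pmf.expectation able_pmf (share N s) = ask_prob (1 - able_prob P) (card N)"
proof -
  have int: "integrable able_pmf f" for f :: "('a \<Rightarrow> bool) \<Rightarrow> real"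
    by (rule integrable_measure_pmf_finite) simp
  have "(\<Sum>s'\<in>N. share N s' able) = 1 - indicator {able. \<forall>s\<in>N. \<not> able s} able" for able
  proof -
    have "(\<Sum>s'\<in>N. share N s' able)
      = (\<Sum>s'\<in>{s'\<in>N. able s'}. 1 / real (card {s'\<in>N. able s'}))"
      unfolding share_def by (intro sum.mono_neutral_cong_right) auto
    also have "\<dots> = (if \<exists>s\<in>N. able s then 1 else 0)" by (auto simp: card_eq_0_iff)
    finally show ?thesis by (auto simp: indicator_def)
  qed
  then have "(\<Sum>s'\<in>N. measure_pmf.expectation able_pmf (share N s'))
    = measure_pmf.expectation able_pmf (\<lambda>able. 1 - indicator {able. \<forall>s\<in>N. \<not> able s} able)"
    by (simp add: Bochner_Integration.integral_sum[symmetric] int)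
  also have "\<dots> = 1 - (1 - able_prob P) ^ card N"
    using prob_none_able[of N] by (simp add: int)
  also have "(\<Sum>s'\<in>N. measure_pmf.expectation able_pmf (share N s'))
    = real (card N) * measure_pmf.expectation able_pmf (share N s)"
    using sum.cong[OF refl expectation_share_eq[OF assms, symmetric]] by simp
  finally have "real (card N) * measure_pmf.expectation able_pmf (share N s)
    = 1 - (1 - able_prob P) ^ card N" .
  moreover have "real (card N) \<noteq> 0" using assms by auto
  ultimately show ?thesis unfolding ask_prob_def by (simp add: eq_divide_eq mult.commute)
qed

lemma pmf_match_stage_Some:
  fixes g :: "'a network"
  shows "pmf (match_stage P g) (Some (r, s))
    = (if s \<in> nbrs g r then alpha P * ask_prob (1 - able_prob P) (link_degree g r) else 0)"
proof -
  define K where "K x able = (case x of None \<Rightarrow> return_pmf None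
      | Some r \<Rightarrow> if \<exists>s\<in>nbrs g r. able s
          then map_pmf (\<lambda>s. Some (r, s)) (pmf_of_set {s\<in>nbrs g r. able s})
          else return_pmf None)" for x able
  have K: "pmf (K x able) (Some (r, s)) = (if x = Some r then share (nbrs g r) s able else 0)"
    for x able
  proof (cases x)
    case (Some r')
    show ?thesis
    proof (cases "r' = r \<and> (\<exists>s\<in>nbrs g r. able s)")
      case True
      then have "{s \<in> nbrs g r. able s} \<noteq> {}" by auto
      moreover have "pmf (map_pmf (\<lambda>s. Some (r, s)) Q) (Some (r, s)) = pmf Q s" for Q :: "'a pmf"
        by (rule pmf_map_inj') (simp add: inj_def)
      ultimately show ?thesis
        using Some True by (auto simp: K_def share_def indicator_def)
    next
      case False
      then show ?thesis
        using Some by (auto simp: K_def share_def pmf_eq_0_set_pmf)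
    qed
  qed (simp add: K_def)
  have "match_stage P g = requester P \<bind> (\<lambda>x. able_pmf \<bind> K x)"
    unfolding match_stage_def able_pmf_def K_def ..
  then have "pmf (match_stage P g) (Some (r, s))
    = measure_pmf.expectation (requester P) (\<lambda>x. if x = Some r then
        measure_pmf.expectation able_pmf (share (nbrs g r) s) else 0)"
    by (auto simp: pmf_bind K intro!: Bochner_Integration.integral_cong)
  also have "\<dots> = alpha P * measure_pmf.expectation able_pmf (share (nbrs g r) s)"
    by (subst integral_measure_pmf[of "{Some r}"]) (auto simp: pmf_requester split: if_splits)
  finally have *: "pmf (match_stage P g) (Some (r, s))
    = alpha P * measure_pmf.expectation able_pmf (share (nbrs g r) s)" .
  show ?thesis
  proof (cases "s \<in> nbrs g r")
    case True
    then show ?thesis unfolding * link_degree_def by (simp add: expectation_share)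
  next
    case False
    then have "share (nbrs g r) s = (\<lambda>_. 0)" by (simp add: share_def fun_eq_iff)
    then show ?thesis unfolding * using False by simp
  qed
qed

lemma pmf_match_stage_pos_iff:
  fixes g :: "'a network"
  shows "0 < pmf (match_stage P g) (Some (r, s)) \<longleftrightarrow> s \<in> nbrs g r"
proof -
  have p: "0 < able_prob P" "able_prob P < 1" "0 < alpha P"
    using valid by (auto simp: valid_params_def)
  have "0 < ask_prob (1 - able_prob P) (link_degree g r)" if "s \<in> nbrs g r"
  proof -
    have "0 < link_degree g r" using that link_degree_pos[of r s g] by (simp add: nbrs_def)
    then show ?thesis using p by (simp add: ask_prob_def power_less_one_iff)
  qed
  then show ?thesis using p by (auto simp: pmf_match_stage_Some)
qed

text \<open>Whoever is drawn, all players may be unable since \<open>p < 1\<close>. Hence any favor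
  can be replaced by no favor without making a history impossible.\<close>

lemma pmf_match_stage_None_pos:
  fixes g :: "'a network"
  shows "0 < pmf (match_stage P g) None"
proof -
  have p: "0 < able_prob P" "able_prob P < 1" using valid by (auto simp: valid_params_def)
  obtain x :: "'a option" where x: "x \<in> set_pmf (requester P)"
    using set_pmf_not_empty by (metis ex_in_conv)
  have "(\<lambda>_. False) \<in> set_pmf (Pi_pmf UNIV False (\<lambda>_ :: 'a. bernoulli_pmf (able_prob P)))"
    using p by (simp add: set_Pi_pmf PiE_dflt_def)
  then have "None \<in> set_pmf (match_stage P g)"
    unfolding match_stage_def set_bind_pmf using x
    by (auto split: option.split intro!: bexI[of _ x] bexI[of _ "\<lambda>_. False"])
  then show ?thesis by (simp add: pmf_positive)
qed

end

section \<open>Expected payoff of one period\<close>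

text \<open>Finite action types make link profiles and favors finite types, so that all
  distributions over a fixed number of periods have finite support and integrability is
  automatic.\<close>

instance link_act :: finite
proof
  have "(UNIV :: link_act set) = {Keep, Remove}" using link_act.exhaust by auto
  then show "finite (UNIV :: link_act set)" by (metis finite.emptyI finite_insert)
qed

instance favor_act :: finite
proof
  have "(UNIV :: favor_act set) = {Provide, Refuse}" using favor_act.exhaust by auto
  then show "finite (UNIV :: favor_act set)" by (metis finite.emptyI finite_insert)
qed

lemma finite_set_pmf_play: "finite (set_pmf (play P \<sigma> g h k))"
  by (induction k) auto

lemma expectation_match_stage:
  fixes g :: "'a :: finite network"
  assumes "valid_params P" "real CARD('a) * alpha P \<le> 1"
  shows "measure_pmf.expectation (match_stage P g)
      (\<lambda>q. case q of None \<Rightarrow> 0 | Some (r, s) \<Rightarrow> F r s)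
    = (\<Sum>r\<in>UNIV. \<Sum>s\<in>nbrs g r. alpha P * ask_prob (1 - able_prob P) (link_degree g r) * F r s)"
proof -
  have "measure_pmf.expectation (match_stage P g)
      (\<lambda>q. case q of None \<Rightarrow> 0 | Some (r, s) \<Rightarrow> F r s)
    = (\<Sum>q\<in>UNIV. pmf (match_stage P g) q * (case q of None \<Rightarrow> 0 | Some (r, s) \<Rightarrow> F r s))"
    by (subst integral_measure_pmf[of UNIV]) auto
  also have "\<dots> = (\<Sum>(r, s)\<in>UNIV. pmf (match_stage P g) (Some (r, s)) * F r s)"
    by (simp add: UNIV_option_conv sum.reindex case_prod_beta)
  also have "\<dots> = (\<Sum>r\<in>UNIV. \<Sum>s\<in>UNIV. pmf (match_stage P g) (Some (r, s)) * F r s)"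
    by (simp add: sum.cartesian_product)
  also have "\<dots> = (\<Sum>r\<in>UNIV. \<Sum>s\<in>nbrs g r.
      alpha P * ask_prob (1 - able_prob P) (link_degree g r) * F r s)"
    by (intro sum.cong refl sum.mono_neutral_cong_right)
      (auto simp: pmf_match_stage_Some[OF assms])
  finally show ?thesis .
qed

text \<open>In the sum over pairs of requester and provider, the row of \<open>i\<close> collects
  the favors received and the column of \<open>i\<close> the favors provided.\<close>

lemma expected_favor_balance:
  fixes g :: "'a :: finite network"
  assumes "valid_params P" "real CARD('a) * alpha P \<le> 1"
  shows "measure_pmf.expectation (match_stage P g)
      (\<lambda>q. case q of None \<Rightarrow> 0
         | Some (r, s) \<Rightarrow> (if r = i then val P else 0) - (if s = i then cost P else 0))
    = net_payoff P g i"
proof -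
  let ?k = "\<lambda>r. alpha P * ask_prob (1 - able_prob P) (link_degree g r)"
  have "(\<Sum>r\<in>UNIV. \<Sum>s\<in>nbrs g r. ?k r * ((if r = i then val P else 0) - (if s = i then cost P else 0)))
    = (\<Sum>r\<in>UNIV. (if r = i then \<Sum>s\<in>nbrs g r. ?k r * val P else 0)
        - (\<Sum>s\<in>nbrs g r. if s = i then ?k r * cost P else 0))"
    by (intro sum.cong refl)
      (simp add: right_diff_distrib sum_subtractf if_distrib[of "(*) _"] cong: if_cong)
  also have "\<dots> = (\<Sum>s\<in>nbrs g i. ?k i * val P) - (\<Sum>r\<in>UNIV. if i \<in> nbrs g r then ?k r * cost P else 0)"
    by (simp add: sum_subtractf sum.delta')
  also have "(\<Sum>r\<in>UNIV. if i \<in> nbrs g r then ?k r * cost P else 0)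
    = (\<Sum>r\<in>nbrs g i. alpha P * cost P * ask_prob (1 - able_prob P) (link_degree g r))"
    by (rule sum.mono_neutral_cong_right) (auto simp: nbrs_sym)
  \<comment> \<open>The equal shares of the neighbors add up to the probability that one of them is
    able; without neighbors both sides are \<open>0\<close>.\<close>
  also have "(\<Sum>s\<in>nbrs g i. ?k i * val P)
    = alpha P * val P * (1 - (1 - able_prob P) ^ link_degree g i)"
    by (cases "link_degree g i = 0") (auto simp: ask_prob_def link_degree_def)
  finally show ?thesis
    unfolding expectation_match_stage[OF assms] net_payoff_ask_prob .
qed


section \<open>Bilateral grim trigger\<close>

text \<open>In the private history of \<open>i \<noteq> j\<close>, \<open>favor_obs j\<close> leaves
  exactly the favors between \<open>i\<close> and \<open>j\<close>. Removals need not be remembered,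
  as a removed link never returns.\<close>

definition soiled_obs :: "'a \<Rightarrow> 'a obs list \<Rightarrow> bool" where
  "soiled_obs j hi \<longleftrightarrow> (\<exists>(li, f)\<in>set hi. \<exists>r s. favor_obs j f = Some (r, s, Refuse))"

definition soiled :: "'a history \<Rightarrow> 'a \<Rightarrow> 'a \<Rightarrow> bool" where
  "soiled h i j \<longleftrightarrow> (\<exists>(l, f)\<in>set h. f = Some (i, j, Refuse) \<or> f = Some (j, i, Refuse))"

definition due_link :: "bool \<Rightarrow> link_act" where
  "due_link b = (if b then Remove else Keep)"

definition due_favor :: "bool \<Rightarrow> favor_act" where
  "due_favor b = (if b then Refuse else Provide)"

text \<open>The drawn \<open>b\<close> is the tremble: with probability \<epsilon> the opposite of
  the due action is taken. \<open>grim 0\<close> is the equilibrium, positive \<epsilon> gives its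
  perturbations.\<close>

definition grim :: "real \<Rightarrow> 'a profile" where
  "grim \<epsilon> = (\<lambda>i.
     \<lparr>link_choice = \<lambda>hi j. map_pmf (\<lambda>b. due_link (b \<noteq> soiled_obs j hi)) (bernoulli_pmf \<epsilon>),
      favor_choice = \<lambda>hi li j. map_pmf (\<lambda>b. due_favor (b \<noteq> soiled_obs j hi)) (bernoulli_pmf \<epsilon>)\<rparr>)"

lemma soiled_commute: "soiled h i j \<longleftrightarrow> soiled h j i"
  unfolding soiled_def by auto

lemma soiled_Nil [simp]: "\<not> soiled [] i j"
  unfolding soiled_def by simp

lemma soiled_snoc [simp]:
  "soiled (h @ [(l, f)]) i j \<longleftrightarrow> soiled h i j \<or> f = Some (i, j, Refuse) \<or> f = Some (j, i, Refuse)"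
  unfolding soiled_def by auto

lemma soiled_obs_private_hist:
  assumes "i \<noteq> j"
  shows "soiled_obs j (private_hist i h) \<longleftrightarrow> soiled h i j"
proof -
  have "(\<exists>r s. favor_obs j (favor_obs i f) = Some (r, s, Refuse))
    \<longleftrightarrow> f = Some (i, j, Refuse) \<or> f = Some (j, i, Refuse)" for f
    using assms by (auto simp: favor_obs_def split: option.splits prod.splits if_splits)
  then show ?thesis
    unfolding soiled_obs_def soiled_def private_hist_def by (force simp: case_prod_beta)
qed

lemma pmf_map_due_link: "pmf (map_pmf (\<lambda>b. due_link (b \<noteq> c)) M) a = pmf M (a \<noteq> due_link c)"
proof -
  have inj: "inj (\<lambda>b. due_link (b \<noteq> c))"
    by (cases c) (auto simp: inj_def due_link_def split: if_splits)
  have a: "due_link ((a \<noteq> due_link c) \<noteq> c) = a"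
    by (cases a) (auto simp: due_link_def)
  show ?thesis using pmf_map_inj'[OF inj, of M "a \<noteq> due_link c"] unfolding a .
qed

lemma pmf_map_due_favor: "pmf (map_pmf (\<lambda>b. due_favor (b \<noteq> c)) M) a = pmf M (a \<noteq> due_favor c)"
proof -
  have inj: "inj (\<lambda>b. due_favor (b \<noteq> c))"
    by (cases c) (auto simp: inj_def due_favor_def split: if_splits)
  have a: "due_favor ((a \<noteq> due_favor c) \<noteq> c) = a"
    by (cases a) (auto simp: due_favor_def)
  show ?thesis using pmf_map_inj'[OF inj, of M "a \<noteq> due_favor c"] unfolding a .
qed

lemma pmf_link_choice_grim:
  assumes "0 \<le> \<epsilon>" "\<epsilon> \<le> 1"
  shows "pmf (link_choice (grim \<epsilon> i) hi j) a = (if a = due_link (soiled_obs j hi) then 1 - \<epsilon> else \<epsilon>)"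
  using assms by (simp add: grim_def pmf_map_due_link del: not_iff)

lemma pmf_favor_choice_grim:
  assumes "0 \<le> \<epsilon>" "\<epsilon> \<le> 1"
  shows "pmf (favor_choice (grim \<epsilon> i) hi li j) a
    = (if a = due_favor (soiled_obs j hi) then 1 - \<epsilon> else \<epsilon>)"
  using assms by (simp add: grim_def pmf_map_due_favor del: not_iff)

lemma link_choice_grim_0: "link_choice (grim 0 i) hi j = return_pmf (due_link (soiled_obs j hi))"
  by (rule pmf_eqI) (auto simp: pmf_link_choice_grim)

lemma favor_choice_grim_0:
  "favor_choice (grim 0 i) hi li j = return_pmf (due_favor (soiled_obs j hi))"
  by (rule pmf_eqI) (auto simp: pmf_favor_choice_grim)

lemma bilaterally_measurable_grim: "bilaterally_measurable (grim \<epsilon> :: 'a profile)"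
proof -
  have "soiled_obs j hi \<longleftrightarrow> (\<exists>(x, f)\<in>set (bilateral j hi). \<exists>r s. f = Some (r, s, Refuse))"
    for j :: 'a and hi
    unfolding soiled_obs_def bilateral_def by (force simp: case_prod_beta)
  then have *: "soiled_obs j hi = soiled_obs j hi'" if "bilateral j hi = bilateral j hi'"
    for j :: 'a and hi hi'
    using that by simp
  show ?thesis
    unfolding bilaterally_measurable_def grim_def strategy.simps by (auto dest!: *)
qed

section \<open>Legal link profiles and histories intact elsewhere\<close>

definition legal :: "'a network \<Rightarrow> 'a link_profile \<Rightarrow> bool" where
  "legal G l \<longleftrightarrow> (\<forall>j k. l (j, k) \<noteq> None \<longleftrightarrow> {j, k} \<in> G)"

lemma kept_iff: "{j, k} \<in> kept l \<longleftrightarrow> l (j, k) = Some Keep \<and> l (k, j) = Some Keep"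
  unfolding kept_def by (auto simp: doubleton_eq_iff)

lemma kept_subset: "legal G l \<Longrightarrow> kept l \<subseteq> G"
  unfolding legal_def kept_def by auto

lemma network_subset: "network g \<Longrightarrow> g' \<subseteq> g \<Longrightarrow> network g'"
  unfolding network_def by auto

lemma current_net_Nil [simp]: "current_net g [] = g"
  by (simp add: current_net_def)

lemma current_net_snoc [simp]: "current_net g (h @ [(l, f)]) = kept l"
  by (simp add: current_net_def)

lemma set_link_stage:
  fixes g :: "'a :: finite network"
  shows "l \<in> set_pmf (link_stage \<sigma> g h) \<longleftrightarrow> legal (current_net g h) l \<and>
    (\<forall>j k a. l (j, k) = Some a \<longrightarrow> a \<in> set_pmf (link_choice (\<sigma> j) (private_hist j h) k))"
proof -
  have "l \<in> set_pmf (link_stage \<sigma> g h) \<longleftrightarrow> (\<forall>j k. if {j, k} \<in> current_net g h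
      then l (j, k) \<in> Some ` set_pmf (link_choice (\<sigma> j) (private_hist j h) k) else l (j, k) = None)"
    by (auto simp: link_stage_def set_Pi_pmf PiE_dflt_def)
  moreover have "(if c then x \<in> Some ` S else x = None)
    \<longleftrightarrow> (x \<noteq> None \<longleftrightarrow> c) \<and> (\<forall>a. x = Some a \<longrightarrow> a \<in> S)" for c S and x :: "link_act option"
    by (cases x) auto
  ultimately show ?thesis unfolding legal_def by (simp only: all_conj_distrib)
qed

lemma set_favor_stage:
  "f \<in> set_pmf (favor_stage \<sigma> h l q) \<longleftrightarrow> (case q of None \<Rightarrow> f = None
     | Some (r, s) \<Rightarrow> \<exists>a\<in>set_pmf (favor_choice (\<sigma> s) (private_hist s h) (link_obs s l) r).
         f = Some (r, s, a))"
  unfolding favor_stage_def by (auto split: option.splits)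

text \<open>The absence of errors between others in the current link stage, which at a favor node is
  not yet part of the history.\<close>

definition quiet :: "'a \<Rightarrow> 'a history \<Rightarrow> 'a link_profile \<Rightarrow> bool" where
  "quiet i h l \<longleftrightarrow>
     (\<forall>j k a. j \<noteq> i \<longrightarrow> k \<noteq> i \<longrightarrow> l (j, k) = Some a \<longrightarrow> a = due_link (soiled h j k))"

text \<open>In the limit of vanishing errors, player \<open>i\<close> is certain to be at such a history.\<close>

definition intact_elsewhere :: "'a network \<Rightarrow> 'a \<Rightarrow> 'a history \<Rightarrow> bool" where
  "intact_elsewhere g i h \<longleftrightarrow> current_net g h \<subseteq> g \<and>
     (\<forall>j k. j \<noteq> i \<longrightarrow> k \<noteq> i \<longrightarrow> {j, k} \<in> g \<longrightarrow> {j, k} \<in> current_net g h \<and> \<not> soiled h j k)"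

lemma intact_elsewhere_kept:
  assumes "intact_elsewhere g i h" "legal (current_net g h) l" "quiet i h l"
    and "j \<noteq> i" "k \<noteq> i" "{j, k} \<in> g"
  shows "{j, k} \<in> kept l"
proof -
  have *: "l (x, y) = Some Keep" if xy: "x \<noteq> i" "y \<noteq> i" "{x, y} \<in> g" for x y
  proof -
    have c: "{x, y} \<in> current_net g h" "\<not> soiled h x y"
      using assms(1) xy by (auto simp: intact_elsewhere_def)
    then obtain a where a: "l (x, y) = Some a" using assms(2) by (auto simp: legal_def)
    then have "a = due_link (soiled h x y)" using assms(3) xy by (auto simp: quiet_def)
    then show ?thesis using c a by (simp add: due_link_def)
  qed
  show ?thesis
    using *[of j k] *[of k j] assms(4-6) by (simp add: kept_iff insert_commute)
qed

lemma intact_elsewhere_snoc: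
  assumes "intact_elsewhere g i h" "legal (current_net g h) l" "quiet i h l"
    and "\<And>r s. f = Some (r, s, Refuse) \<Longrightarrow> r \<noteq> i \<Longrightarrow> s \<noteq> i \<Longrightarrow> {r, s} \<notin> g"
  shows "intact_elsewhere g i (h @ [(l, f)])"
proof -
  have "kept l \<subseteq> g"
    using assms(1,2) kept_subset by (auto simp: intact_elsewhere_def)
  moreover have "{j, k} \<in> kept l" if "j \<noteq> i" "k \<noteq> i" "{j, k} \<in> g" for j k
    using that intact_elsewhere_kept[OF assms(1-3)] by blast
  moreover have "\<not> soiled (h @ [(l, f)]) j k" if "j \<noteq> i" "k \<noteq> i" "{j, k} \<in> g" for j k
    using that assms(1,4) by (auto simp: intact_elsewhere_def insert_commute)
  ultimately show ?thesis unfolding intact_elsewhere_def by simp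
qed


section \<open>Optimality of grim trigger\<close>

lemma expectation_mono_finite:
  fixes f f' :: "'b \<Rightarrow> real"
  assumes "finite (set_pmf p)" "\<And>x. x \<in> set_pmf p \<Longrightarrow> f x \<le> f' x"
  shows "measure_pmf.expectation p f \<le> measure_pmf.expectation p f'"
  using assms by (auto simp: integral_measure_pmf[of "set_pmf p"] intro!: sum_mono mult_left_mono)

lemma expectation_cong_set:
  fixes f f' :: "'b \<Rightarrow> real"
  assumes "\<And>x. x \<in> set_pmf p \<Longrightarrow> f x = f' x"
  shows "measure_pmf.expectation p f = measure_pmf.expectation p f'"
  by (rule integral_cong_AE) (auto simp: AE_measure_pmf_iff assms)

lemma expectation_le_const:
  fixes f :: "'b \<Rightarrow> real"
  assumes "finite (set_pmf p)" "\<And>x. x \<in> set_pmf p \<Longrightarrow> f x \<le> C"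
  shows "measure_pmf.expectation p f \<le> C"
  using expectation_mono_finite[of p f "\<lambda>_. C"] assms by simp

lemma expectation_abs_le:
  fixes f :: "'b \<Rightarrow> real"
  assumes "finite (set_pmf p)" "\<And>x. x \<in> set_pmf p \<Longrightarrow> \<bar>f x\<bar> \<le> C"
  shows "\<bar>measure_pmf.expectation p f\<bar> \<le> C"
  using expectation_le_const[of p f C] expectation_le_const[of p "\<lambda>x. - f x" C] assms
  by (simp add: abs_le_iff)

lemma abs_favor_payoff_le:
  assumes "valid_params P"
  shows "\<bar>favor_payoff P i f\<bar> \<le> val P"
  using assms
  by (auto simp: favor_payoff_def valid_params_def split: option.split favor_act.split)

text \<open>The verification argument of dynamic programming: if on an invariant set
  \<open>R\<close> dominates the expected payoff of one period plus the discounted next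
  \<open>R\<close>, then these inequalities telescope.\<close>

lemma partial_discounted_sum:
  fixes u :: "'a :: finite favor \<Rightarrow> real"
  assumes inv: "\<And>h x. I h \<Longrightarrow> x \<in> set_pmf (play_period P \<sigma> g h) \<Longrightarrow> I (h @ [x])"
    and I: "I h"
    and step: "\<And>h. I h \<Longrightarrow> measure_pmf.expectation (play_period P \<sigma> g h)
      (\<lambda>x. u (snd x) + d * R (h @ [x])) \<le> R h"
    and nonneg: "0 \<le> d"
  shows "(\<Sum>k<n. d ^ k * measure_pmf.expectation (play P \<sigma> g h (Suc k)) (\<lambda>h'. u (snd (last h'))))
    \<le> R h - d ^ n * measure_pmf.expectation (play P \<sigma> g h n) R"
proof -
  have I_play: "I h'" if "h' \<in> set_pmf (play P \<sigma> g h k)" for h' k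
    using that by (induction k arbitrary: h') (auto simp: I inv)
  have int: "integrable (play P \<sigma> g h k) f" for k and f :: "_ \<Rightarrow> real"
    by (rule integrable_measure_pmf_finite) (rule finite_set_pmf_play)
  have exp_play_Suc: "measure_pmf.expectation (play P \<sigma> g h (Suc k)) f
    = measure_pmf.expectation (play P \<sigma> g h k) (\<lambda>h'.
        measure_pmf.expectation (play_period P \<sigma> g h') (\<lambda>x. f (h' @ [x])))"
    for k and f :: "_ \<Rightarrow> real"
    by (simp add: expectation_bind_finite finite_set_pmf_play)
  have one: "measure_pmf.expectation (play P \<sigma> g h (Suc k)) (\<lambda>h'. u (snd (last h')))
    + d * measure_pmf.expectation (play P \<sigma> g h (Suc k)) R
    \<le> measure_pmf.expectation (play P \<sigma> g h k) R" for k
  proof -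
    have "measure_pmf.expectation (play P \<sigma> g h (Suc k)) (\<lambda>h'. u (snd (last h')))
        + d * measure_pmf.expectation (play P \<sigma> g h (Suc k)) R
      = measure_pmf.expectation (play P \<sigma> g h (Suc k)) (\<lambda>h'. u (snd (last h')) + d * R h')"
      by (simp add: int del: play.simps)
    also have "\<dots> = measure_pmf.expectation (play P \<sigma> g h k) (\<lambda>h'.
        measure_pmf.expectation (play_period P \<sigma> g h') (\<lambda>x. u (snd x) + d * R (h' @ [x])))"
      unfolding exp_play_Suc by simp
    also have "\<dots> \<le> measure_pmf.expectation (play P \<sigma> g h k) R"
      using step I_play by (intro expectation_mono_finite finite_set_pmf_play) blast
    finally show ?thesis .
  qed
  show ?thesis
  proof (induction n)
    case (Suc n)
    have "d ^ n * (measure_pmf.expectation (play P \<sigma> g h (Suc n)) (\<lambda>h'. u (snd (last h')))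
        + d * measure_pmf.expectation (play P \<sigma> g h (Suc n)) R)
      \<le> d ^ n * measure_pmf.expectation (play P \<sigma> g h n) R"
      using one[of n] nonneg by (intro mult_left_mono) auto
    then show ?case
      using Suc by (simp add: algebra_simps del: play.simps)
  qed simp
qed

lemma summable_discounted:
  fixes a :: "nat \<Rightarrow> real"
  assumes "0 < d" "d < 1" "\<And>k. \<bar>a k\<bar> \<le> C"
  shows "summable (\<lambda>k. d ^ k * a k)"
proof (rule summable_comparison_test')
  show "summable (\<lambda>k. d ^ k * C)"
    using assms by (intro summable_mult2 summable_geometric) auto
  show "norm (d ^ k * a k) \<le> d ^ k * C" for k
    using assms by (simp add: abs_mult)
qed

text \<open>As \<open>R\<close> is bounded, the remainder of the telescoped inequality vanishes with
  \<open>d ^ n\<close>.\<close>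

lemma discounted_sum_le:
  fixes u :: "'a :: finite favor \<Rightarrow> real"
  assumes d: "0 < d" "d < 1" and u: "\<And>f. \<bar>u f\<bar> \<le> D" and R: "\<And>h. \<bar>R h\<bar> \<le> C"
    and inv: "\<And>h x. I h \<Longrightarrow> x \<in> set_pmf (play_period P \<sigma> g h) \<Longrightarrow> I (h @ [x])"
    and I: "I h"
    and step: "\<And>h. I h \<Longrightarrow> measure_pmf.expectation (play_period P \<sigma> g h)
      (\<lambda>x. u (snd x) + d * R (h @ [x])) \<le> R h"
  shows "(\<Sum>k. d ^ k * measure_pmf.expectation (play P \<sigma> g h (Suc k)) (\<lambda>h'. u (snd (last h'))))
    \<le> R h"
proof -
  let ?a = "\<lambda>k. measure_pmf.expectation (play P \<sigma> g h (Suc k)) (\<lambda>h'. u (snd (last h')))"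
  have "\<bar>?a k\<bar> \<le> D" for k
    by (intro expectation_abs_le finite_set_pmf_play u)
  then have sums: "(\<lambda>n. \<Sum>k<n. d ^ k * ?a k) \<longlonglongrightarrow> (\<Sum>k. d ^ k * ?a k)"
    using d by (intro summable_LIMSEQ summable_discounted)
  have "\<bar>measure_pmf.expectation (play P \<sigma> g h n) R\<bar> \<le> C" for n
    by (intro expectation_abs_le finite_set_pmf_play R)
  then have "(\<lambda>n. d ^ n * measure_pmf.expectation (play P \<sigma> g h n) R) \<longlonglongrightarrow> 0"
    using d by (intro summable_LIMSEQ_zero summable_discounted)
  then have lim: "(\<lambda>n. R h - d ^ n * measure_pmf.expectation (play P \<sigma> g h n) R) \<longlonglongrightarrow> R h - 0"
    by (intro tendsto_diff tendsto_const)
  have "(\<Sum>k<n. d ^ k * ?a k) \<le> R h - d ^ n * measure_pmf.expectation (play P \<sigma> g h n) R" for n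
    by (rule partial_discounted_sum[of I, OF inv I step]) (use d in auto)
  then show ?thesis
    using LIMSEQ_le[OF sums lim] by simp
qed

lemma link_value_le:
  assumes valid: "valid_params P" and R: "\<And>h. \<bar>R h\<bar> \<le> C"
    and inv: "\<And>h x. I h \<Longrightarrow> x \<in> set_pmf (play_period P \<sigma> g h) \<Longrightarrow> I (h @ [x])"
    and I: "I h"
    and step: "\<And>h. I h \<Longrightarrow> measure_pmf.expectation (play_period P \<sigma> g h)
      (\<lambda>x. favor_payoff P i (snd x) + disc P * R (h @ [x])) \<le> R h"
  shows "link_value P g \<sigma> i h \<le> R h"
  unfolding link_value_def
proof (rule discounted_sum_le[of _ _ "val P" _ C I])
  show "0 < disc P" "disc P < 1" using valid by (auto simp: valid_params_def)
qed (use assms abs_favor_payoff_le[OF valid] in auto)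

text \<open>The upper bound applied to the negated payoff and to \<open>- R\<close>.\<close>

lemma link_value_ge:
  assumes valid: "valid_params P" and R: "\<And>h. \<bar>R h\<bar> \<le> C"
    and inv: "\<And>h x. I h \<Longrightarrow> x \<in> set_pmf (play_period P \<sigma> g h) \<Longrightarrow> I (h @ [x])"
    and I: "I h"
    and step: "\<And>h. I h \<Longrightarrow> R h \<le> measure_pmf.expectation (play_period P \<sigma> g h)
      (\<lambda>x. favor_payoff P i (snd x) + disc P * R (h @ [x]))"
  shows "R h \<le> link_value P g \<sigma> i h"
proof -
  let ?a = "\<lambda>k. measure_pmf.expectation (play P \<sigma> g h (Suc k)) (\<lambda>h'. favor_payoff P i (snd (last h')))"
  have d: "0 < disc P" "disc P < 1" using valid by (auto simp: valid_params_def)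
  have "\<bar>?a k\<bar> \<le> val P" for k
    using valid by (intro expectation_abs_le finite_set_pmf_play abs_favor_payoff_le)
  then have "summable (\<lambda>k. disc P ^ k * ?a k)"
    using d by (intro summable_discounted)
  then have "- link_value P g \<sigma> i h = (\<Sum>k. disc P ^ k * measure_pmf.expectation (play P \<sigma> g h (Suc k))
      (\<lambda>h'. - favor_payoff P i (snd (last h'))))"
    unfolding link_value_def by (simp add: suminf_minus[symmetric] del: play.simps)
  also have "\<dots> \<le> - R h"
  proof (rule discounted_sum_le[where R = "\<lambda>h. - R h" and D = "val P" and C = C and I = I])
    fix h assume "I h"
    have "measure_pmf.expectation (play_period P \<sigma> g h)
        (\<lambda>x. - favor_payoff P i (snd x) + disc P * - R (h @ [x]))
      = - measure_pmf.expectation (play_period P \<sigma> g h)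
        (\<lambda>x. favor_payoff P i (snd x) + disc P * R (h @ [x]))"
      by (simp flip: Bochner_Integration.integral_minus)
    then show "measure_pmf.expectation (play_period P \<sigma> g h)
        (\<lambda>x. - favor_payoff P i (snd x) + disc P * - R (h @ [x])) \<le> - R h"
      using step[OF \<open>I h\<close>] by simp
  qed (use d R inv I abs_favor_payoff_le[OF valid] in auto)
  finally show ?thesis by simp
qed

section \<open>The potential and its evolution over one period\<close>

text \<open>The network is a separate argument because the links are counted both before and after
  the link stage that follows \<open>h\<close>.\<close>

definition clean_links :: "'a \<Rightarrow> 'a history \<Rightarrow> 'a network \<Rightarrow> 'a set" where
  "clean_links i h G = {j. {i, j} \<in> G \<and> \<not> soiled h i j}"

text \<open>Soiled links count as lost already, since a partner who follows grim trigger removes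
  them at the next link stage.\<close>

definition potential :: "params \<Rightarrow> nat \<Rightarrow> 'a network \<Rightarrow> 'a \<Rightarrow> 'a history \<Rightarrow> real" where
  "potential P B g i h
     = regular_payoff P B (card (clean_links i h (current_net g h))) / (1 - disc P)"

locale regular_game =
  fixes P :: params and B :: nat and g :: "'a :: finite network"
  assumes valid: "valid_params P"
    and few: "real CARD('a) * alpha P \<le> 1"
    and bound: "cooperation_bound P B"
    and net: "network g"
    and regular: "\<And>i. link_degree g i = B"
begin

definition lifetime :: "nat \<Rightarrow> real" where
  "lifetime m = regular_payoff P B m / (1 - disc P)"

text \<open>The continuation is valued by the potential, which at intact histories will turn out to
  be its value under grim trigger.\<close>

definition future :: "'a \<Rightarrow> 'a history \<Rightarrow> 'a link_profile \<Rightarrow> 'a favor \<Rightarrow> real" where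
  "future i h l f = favor_payoff P i f + disc P * potential P B g i (h @ [(l, f)])"

lemma disc: "0 < disc P" "disc P < 1"
  using valid by (auto simp: valid_params_def)

lemma lifetime_mono: "m \<le> n \<Longrightarrow> n \<le> B \<Longrightarrow> lifetime m \<le> lifetime n"
  unfolding lifetime_def using disc
  by (intro divide_right_mono regular_payoff_mono[OF valid bound]) auto

text \<open>The saving from one refusal never exceeds the discounted value of the link that it
  destroys.\<close>

lemma lifetime_Suc_gain:
  assumes "m < B"
  shows "disc P * lifetime (Suc m) - disc P * lifetime m \<ge> cost P - refuse_cost P"
proof -
  have "disc P * lifetime (Suc m) - disc P * lifetime m
    = disc P * (regular_payoff P B (Suc m) - regular_payoff P B m) / (1 - disc P)"
    unfolding lifetime_def by (simp add: diff_divide_distrib right_diff_distrib)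
  then show ?thesis
    using regular_payoff_Suc_gain[OF valid bound assms] disc by (simp add: pos_le_divide_eq mult.commute)
qed

lemma lifetime_unfold: "regular_payoff P B m + disc P * lifetime m = lifetime m"
  unfolding lifetime_def using disc by (simp add: field_simps)

lemma potential_bounded: "\<exists>C. \<forall>h. \<bar>potential P B g i h\<bar> \<le> C"
proof (intro exI allI)
  fix h
  have "card (clean_links i h (current_net g h)) \<in> {..CARD('a)}"
    by (simp add: card_mono)
  then show "\<bar>potential P B g i h\<bar> \<le> (\<Sum>m\<in>{..CARD('a)}. \<bar>lifetime m\<bar>)"
    unfolding potential_def lifetime_def[symmetric]
    by (intro member_le_sum[where f = "\<lambda>m. \<bar>lifetime m\<bar>"]) auto
qed

lemma clean_links_snoc:
  "clean_links i (h @ [(l, f)]) (kept l)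
    = clean_links i h (kept l) - {j. f = Some (i, j, Refuse) \<or> f = Some (j, i, Refuse)}"
  unfolding clean_links_def by auto

lemma potential_snoc:
  "potential P B g i (h @ [(l, f)]) = lifetime (card (clean_links i h (kept l)
      - {j. f = Some (i, j, Refuse) \<or> f = Some (j, i, Refuse)}))"
  unfolding potential_def lifetime_def by (simp add: clean_links_snoc)

lemma kept_subset_net:
  assumes "intact_elsewhere g i h" "legal (current_net g h) l"
  shows "kept l \<subseteq> g"
  using assms kept_subset by (auto simp: intact_elsewhere_def)

lemma card_clean_links_le:
  assumes "intact_elsewhere g i h" "legal (current_net g h) l"
  shows "card (clean_links i h (kept l)) \<le> B"
proof -
  have "clean_links i h (kept l) \<subseteq> nbrs g i"
    using kept_subset_net[OF assms] by (auto simp: clean_links_def nbrs_def)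
  then have "card (clean_links i h (kept l)) \<le> card (nbrs g i)" by (intro card_mono) auto
  then show ?thesis using regular[of i] by (simp add: link_degree_def)
qed

text \<open>A soiled link no longer counts in the potential, so refusing on it saves c - \<gamma> at
  no further loss. On a clean link refusing costs one unit of \<open>lifetime\<close>, which
  outweighs the saving.\<close>

lemma due_favor_optimal:
  assumes "intact_elsewhere g i h" "legal (current_net g h) l" "{i, r} \<in> kept l"
  shows "future i h l (Some (r, i, a)) \<le> future i h l (Some (r, i, due_favor (soiled h i r)))"
    and "\<not> soiled h i r \<Longrightarrow> future i h l (Some (r, i, Provide))
      = - cost P + disc P * lifetime (card (clean_links i h (kept l)))"
proof -
  let ?M = "clean_links i h (kept l)"
  have ri: "r \<noteq> i"
    using assms(3) kept_subset_net[OF assms(1,2)] net network_no_loop by fastforce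
  have provide: "future i h l (Some (r, i, Provide)) = - cost P + disc P * lifetime (card ?M)"
    using ri unfolding future_def potential_snoc by (simp add: favor_payoff_def)
  have refuse: "future i h l (Some (r, i, Refuse)) = - refuse_cost P + disc P * lifetime (card (?M - {r}))"
  proof -
    have "{j. Some (r, i, Refuse) = Some (i, j, Refuse) \<or> Some (r, i, Refuse) = Some (j, i, Refuse)} = {r}"
      using ri by auto
    then show ?thesis unfolding future_def potential_snoc by (simp add: favor_payoff_def)
  qed
  show "future i h l (Some (r, i, a)) \<le> future i h l (Some (r, i, due_favor (soiled h i r)))"
  proof (cases "soiled h i r")
    case True
    then have "?M - {r} = ?M" by (auto simp: clean_links_def)
    moreover have "refuse_cost P \<le> cost P" using valid by (simp add: valid_params_def)
    ultimately show ?thesis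
      using True provide refuse by (cases a) (auto simp: due_favor_def)
  next
    case False
    then have "r \<in> ?M" using assms(3) by (simp add: clean_links_def)
    then have card: "card ?M = Suc (card (?M - {r}))"
      by (metis card.remove finite)
    then have "card (?M - {r}) < B" using card_clean_links_le[OF assms(1,2)] by simp
    then show ?thesis
      using False provide refuse lifetime_Suc_gain[of "card (?M - {r})"] card
      by (cases a) (auto simp: due_favor_def)
  qed
  show "future i h l (Some (r, i, Provide)) = - cost P + disc P * lifetime (card ?M)"
    by (rule provide)
qed

text \<open>Only \<open>i\<close> deviates. Whatever she does, the other end removes each of her
  soiled links, so that the links left to her are all clean.\<close>

lemma deviation_link_stage:
  assumes "intact_elsewhere g i h" "l \<in> set_pmf (link_stage ((grim 0)(i := s)) g h)"
  shows "legal (current_net g h) l" "quiet i h l" "nbrs (kept l) i = clean_links i h (kept l)"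
    "kept l \<subseteq> g"
proof -
  show legal: "legal (current_net g h) l" using assms(2) by (simp add: set_link_stage)
  show sub: "kept l \<subseteq> g" by (rule kept_subset_net[OF assms(1) legal])
  have due: "a = due_link (soiled h j k)" if "j \<noteq> i" "l (j, k) = Some a" for j k a
  proof -
    have "{j, k} \<in> g"
      using that legal assms(1) by (auto simp: legal_def intact_elsewhere_def)
    then have "j \<noteq> k" using net network_no_loop by fastforce
    have "a \<in> set_pmf (link_choice (((grim 0)(i := s)) j) (private_hist j h) k)"
      using assms(2)[unfolded set_link_stage] that(2) by blast
    then show ?thesis
      using that \<open>j \<noteq> k\<close> by (simp add: link_choice_grim_0 soiled_obs_private_hist)
  qed
  then show "quiet i h l" by (auto simp: quiet_def)
  have "\<not> soiled h i j" if "{i, j} \<in> kept l" for j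
  proof -
    have "j \<noteq> i" using that sub net network_no_loop by fastforce
    then have "Keep = due_link (soiled h j i)" using due that by (auto simp: kept_iff)
    then show ?thesis by (auto simp: due_link_def soiled_commute split: if_splits)
  qed
  then show "nbrs (kept l) i = clean_links i h (kept l)"
    by (auto simp: nbrs_def clean_links_def)
qed

text \<open>Each remaining neighbor of \<open>i\<close> still has all her links: those with others
  are intact, and the one with \<open>i\<close> was kept. So all these neighbors have degree
  \<open>B\<close>.\<close>

lemma net_payoff_kept:
  assumes "intact_elsewhere g i h" "legal (current_net g h) l" "quiet i h l"
    and "nbrs (kept l) i = clean_links i h (kept l)"
  shows "net_payoff P (kept l) i = regular_payoff P B (card (clean_links i h (kept l)))"
proof -
  have sub: "kept l \<subseteq> g" by (rule kept_subset_net[OF assms(1,2)])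
  have "link_degree (kept l) r = B" if r: "r \<in> nbrs (kept l) i" for r
  proof -
    have "r \<noteq> i" using r sub not_in_own_nbrs[OF network_subset[OF net sub]] by auto
    have ri: "{r, i} \<in> kept l" using r by (simp add: nbrs_def insert_commute)
    have "{r, k} \<in> kept l" if "{r, k} \<in> g" for k
      using that ri intact_elsewhere_kept[OF assms(1-3) \<open>r \<noteq> i\<close>] by (cases "k = i") auto
    then have "nbrs (kept l) r = nbrs g r"
      using sub unfolding nbrs_def by blast
    then show ?thesis using regular[of r] by (simp add: link_degree_def)
  qed
  then have "(\<Sum>j\<in>nbrs (kept l) i. alpha P * cost P * ask_prob (1 - able_prob P) (link_degree (kept l) j))
    = real (card (nbrs (kept l) i)) * (alpha P * cost P * ask_prob (1 - able_prob P) B)"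
    by simp
  then show ?thesis
    unfolding net_payoff_ask_prob regular_payoff_def by (simp add: link_degree_def assms(4))
qed

text \<open>No surviving link is soiled, so grim trigger provides every favor. A deviation matters
  only if \<open>i\<close> is the provider, and there \<open>due_favor_optimal\<close>
  applies.\<close>

lemma favor_stage_future:
  assumes intact: "intact_elsewhere g i h"
    and l: "legal (current_net g h) l" "quiet i h l" "nbrs (kept l) i = clean_links i h (kept l)"
    and q: "q \<in> set_pmf (match_stage P (kept l))"
  defines "target \<equiv> disc P * lifetime (card (clean_links i h (kept l))) + (case q of None \<Rightarrow> 0
         | Some (r, s) \<Rightarrow> (if r = i then val P else 0) - (if s = i then cost P else 0))"
  shows "measure_pmf.expectation (favor_stage ((grim 0)(i := s)) h l q) (future i h l) \<le> target"
    and "measure_pmf.expectation (favor_stage (grim 0) h l q) (future i h l) = target"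
proof -
  let ?M = "clean_links i h (kept l)"
  have sub: "kept l \<subseteq> g" by (rule kept_subset_net[OF intact l(1)])
  have "measure_pmf.expectation (favor_stage ((grim 0)(i := s)) h l q) (future i h l) \<le> target \<and>
    measure_pmf.expectation (favor_stage (grim 0) h l q) (future i h l) = target"
  proof (cases q)
    case None
    then show ?thesis
      by (simp add: favor_stage_def future_def potential_snoc favor_payoff_def target_def)
  next
    case (Some rj)
    then obtain r j where q': "q = Some (r, j)" by (cases rj) auto
    have "0 < pmf (match_stage P (kept l)) (Some (r, j))"
      using q q' by (simp add: pmf_positive)
    then have rj: "{r, j} \<in> kept l"
      using pmf_match_stage_pos_iff[OF valid few] by (simp add: nbrs_def)
    then have ne: "r \<noteq> j" using sub net network_no_loop by fastforce
    \<comment> \<open>A surviving link of \<open>i\<close> is clean by the third assumption of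
      \<open>l\<close>; one between two others is clean because the history is intact
      elsewhere.\<close>
    have unsoiled: "\<not> soiled h r j"
    proof (cases "r = i \<or> j = i")
      case True
      then have "(if r = i then j else r) \<in> nbrs (kept l) i"
        using rj by (auto simp: nbrs_def insert_commute)
      then show ?thesis unfolding l(3) using True by (auto simp: clean_links_def soiled_commute)
    next
      case False
      then show ?thesis using intact rj sub by (auto simp: intact_elsewhere_def)
    qed
    have grim: "favor_stage (grim 0) h l q = return_pmf (Some (r, j, Provide))"
      using ne unsoiled
      by (simp add: q' favor_stage_def favor_choice_grim_0 soiled_obs_private_hist soiled_commute
          due_favor_def)
    have provide: "future i h l (Some (r, j, Provide)) = target"
      using ne unfolding future_def potential_snoc target_def q'
      by (simp add: favor_payoff_def)
    show ?thesis
    proof (cases "j = i")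
      case False
      then have "favor_stage ((grim 0)(i := s)) h l q = favor_stage (grim 0) h l q"
        by (simp add: q' favor_stage_def)
      then show ?thesis by (simp add: grim provide)
    next
      case True
      have "future i h l f \<le> target" if f: "f \<in> set_pmf (favor_stage ((grim 0)(i := s)) h l q)" for f
      proof -
        obtain a where "f = Some (r, i, a)" using f by (auto simp: set_favor_stage q' True)
        then show ?thesis
          using due_favor_optimal(1)[OF intact l(1), of r a] provide rj True unsoiled
          by (simp add: insert_commute soiled_commute due_favor_def)
      qed
      then show ?thesis by (simp add: expectation_le_const grim provide)
    qed
  qed
  then show "measure_pmf.expectation (favor_stage ((grim 0)(i := s)) h l q) (future i h l) \<le> target"
    and "measure_pmf.expectation (favor_stage (grim 0) h l q) (future i h l) = target" by auto
qed

text \<open>Averaging over the matching turns the favor balance into \<open>regular_payoff\<close>;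
  with the discounted \<open>lifetime\<close> this is again \<open>lifetime\<close>.\<close>

lemma match_stage_future:
  assumes intact: "intact_elsewhere g i h"
    and l: "legal (current_net g h) l" "quiet i h l" "nbrs (kept l) i = clean_links i h (kept l)"
  shows "measure_pmf.expectation (match_stage P (kept l)) (\<lambda>q.
      measure_pmf.expectation (favor_stage ((grim 0)(i := s)) h l q) (future i h l))
      \<le> lifetime (card (clean_links i h (kept l)))"
    and "measure_pmf.expectation (match_stage P (kept l)) (\<lambda>q.
      measure_pmf.expectation (favor_stage (grim 0) h l q) (future i h l))
      = lifetime (card (clean_links i h (kept l)))"
proof -
  let ?m = "card (clean_links i h (kept l))"
  let ?t = "\<lambda>q. disc P * lifetime ?m + (case q of None \<Rightarrow> 0
         | Some (r, s) \<Rightarrow> (if r = i then val P else 0) - (if s = i then cost P else 0))"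
  have int: "integrable (match_stage P (kept l)) f" for f :: "_ \<Rightarrow> real"
    by (rule integrable_measure_pmf_finite) simp
  have t: "measure_pmf.expectation (match_stage P (kept l)) ?t = lifetime ?m"
    using expected_favor_balance[OF valid few, of "kept l" i] net_payoff_kept[OF intact l]
      lifetime_unfold[of ?m] by (simp add: int)
  have "measure_pmf.expectation (match_stage P (kept l)) (\<lambda>q.
      measure_pmf.expectation (favor_stage ((grim 0)(i := s)) h l q) (future i h l))
    \<le> measure_pmf.expectation (match_stage P (kept l)) ?t"
    by (intro expectation_mono_finite favor_stage_future(1)[OF intact l]) auto
  then show "measure_pmf.expectation (match_stage P (kept l)) (\<lambda>q.
      measure_pmf.expectation (favor_stage ((grim 0)(i := s)) h l q) (future i h l)) \<le> lifetime ?m"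
    unfolding t .
  have "measure_pmf.expectation (match_stage P (kept l)) (\<lambda>q.
      measure_pmf.expectation (favor_stage (grim 0) h l q) (future i h l))
    = measure_pmf.expectation (match_stage P (kept l)) ?t"
    by (intro expectation_cong_set favor_stage_future(2)[OF intact l])
  then show "measure_pmf.expectation (match_stage P (kept l)) (\<lambda>q.
      measure_pmf.expectation (favor_stage (grim 0) h l q) (future i h l)) = lifetime ?m"
    unfolding t .
qed

lemma expectation_play_period:
  fixes F :: "'a period \<Rightarrow> real"
  shows "measure_pmf.expectation (play_period P \<sigma> g h) F
    = measure_pmf.expectation (link_stage \<sigma> g h) (\<lambda>l.
        measure_pmf.expectation (match_stage P (kept l)) (\<lambda>q.
          measure_pmf.expectation (favor_stage \<sigma> h l q) (\<lambda>f. F (l, f))))"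
  unfolding play_period_def by (simp add: expectation_bind_finite)

lemma clean_links_kept_subset:
  "legal (current_net g h) l \<Longrightarrow> clean_links i h (kept l) \<subseteq> clean_links i h (current_net g h)"
  using kept_subset by (auto simp: clean_links_def)

lemma card_clean_links_current_le:
  assumes "intact_elsewhere g i h"
  shows "card (clean_links i h (current_net g h)) \<le> B"
proof -
  have "clean_links i h (current_net g h) \<subseteq> nbrs g i"
    using assms by (auto simp: clean_links_def nbrs_def intact_elsewhere_def)
  then have "card (clean_links i h (current_net g h)) \<le> card (nbrs g i)" by (intro card_mono) auto
  then show ?thesis using regular[of i] by (simp add: link_degree_def)
qed

text \<open>The link stage can only shrink the set of clean links, and \<open>lifetime\<close>
  increases with their number up to \<open>B\<close>.\<close>

lemma deviation_step:
  assumes "intact_elsewhere g i h"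
  shows "measure_pmf.expectation (play_period P ((grim 0)(i := s)) g h)
      (\<lambda>x. favor_payoff P i (snd x) + disc P * potential P B g i (h @ [x])) \<le> potential P B g i h"
  unfolding expectation_play_period snd_conv future_def[symmetric]
proof (rule expectation_le_const)
  fix l assume "l \<in> set_pmf (link_stage ((grim 0)(i := s)) g h)"
  note l = deviation_link_stage[OF assms this]
  have "card (clean_links i h (kept l)) \<le> card (clean_links i h (current_net g h))"
    by (intro card_mono clean_links_kept_subset l) auto
  then have "lifetime (card (clean_links i h (kept l))) \<le> potential P B g i h"
    unfolding potential_def lifetime_def[symmetric]
    using card_clean_links_current_le[OF assms] by (rule lifetime_mono)
  then show "measure_pmf.expectation (match_stage P (kept l)) (\<lambda>q.
      measure_pmf.expectation (favor_stage ((grim 0)(i := s)) h l q) (future i h l))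
    \<le> potential P B g i h"
    using match_stage_future(1)[OF assms l(1-3), of s] by linarith
qed simp

text \<open>Under grim trigger both ends keep every clean link, so nothing is lost at the link
  stage, and the later stages hold with equality.\<close>

lemma grim_step:
  assumes "intact_elsewhere g i h"
  shows "potential P B g i h \<le> measure_pmf.expectation (play_period P (grim 0) g h)
      (\<lambda>x. favor_payoff P i (snd x) + disc P * potential P B g i (h @ [x]))"
proof -
  have "measure_pmf.expectation (match_stage P (kept l)) (\<lambda>q.
      measure_pmf.expectation (favor_stage (grim 0) h l q) (future i h l)) = potential P B g i h"
    if l_grim: "l \<in> set_pmf (link_stage (grim 0) g h)" for l
  proof -
    \<comment> \<open>Grim trigger is viewed as a trivial deviation, so that the facts about
      deviations apply.\<close>
    have l_dev: "l \<in> set_pmf (link_stage ((grim 0)(i := grim 0 i)) g h)" using l_grim by simp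
    note l = deviation_link_stage[OF assms l_dev]
    have keep: "l (j, k) = Some Keep" if jk: "{j, k} \<in> current_net g h" "\<not> soiled h j k" for j k
    proof -
      have "j \<noteq> k" using jk assms net network_no_loop by (fastforce simp: intact_elsewhere_def)
      obtain a where a: "l (j, k) = Some a" using jk l(1) by (auto simp: legal_def)
      then have "a \<in> set_pmf (link_choice (grim 0 j) (private_hist j h) k)"
        using l_grim[unfolded set_link_stage] by blast
      then show ?thesis
        using a jk \<open>j \<noteq> k\<close> by (simp add: link_choice_grim_0 soiled_obs_private_hist due_link_def)
    qed
    have "{i, j} \<in> kept l" if "{i, j} \<in> current_net g h" "\<not> soiled h i j" for j
      using keep[of i j] keep[of j i] that
      by (simp add: kept_iff insert_commute[of j i] soiled_commute[of h j i])
    then have "clean_links i h (current_net g h) \<subseteq> clean_links i h (kept l)"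
      by (auto simp: clean_links_def)
    then have "clean_links i h (kept l) = clean_links i h (current_net g h)"
      using clean_links_kept_subset[OF l(1)] by blast
    then show ?thesis
      using match_stage_future(2)[OF assms l(1-3)] by (simp add: potential_def lifetime_def)
  qed
  then have "measure_pmf.expectation (play_period P (grim 0) g h)
      (\<lambda>x. favor_payoff P i (snd x) + disc P * potential P B g i (h @ [x]))
    = measure_pmf.expectation (link_stage (grim 0) g h) (\<lambda>_. potential P B g i h)"
    unfolding expectation_play_period snd_conv future_def[symmetric]
    by (intro expectation_cong_set)
  then show ?thesis by simp
qed

text \<open>A deviation of \<open>i\<close> leaves the links between two others alone: their ends
  see no refusal on them and go on keeping and providing. This is the invariant for the verification
  argument.\<close>

lemma deviation_preserves_intact:
  assumes "intact_elsewhere g i h" "x \<in> set_pmf (play_period P ((grim 0)(i := s)) g h)"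
  shows "intact_elsewhere g i (h @ [x])"
proof -
  obtain l f q where x: "x = (l, f)" and l: "l \<in> set_pmf (link_stage ((grim 0)(i := s)) g h)"
    and f: "f \<in> set_pmf (favor_stage ((grim 0)(i := s)) h l q)"
    using assms(2) by (auto simp: play_period_def)
  note l' = deviation_link_stage[OF assms(1) l]
  have "{r, j} \<notin> g" if "f = Some (r, j, Refuse)" "r \<noteq> i" "j \<noteq> i" for r j
  proof
    assume rj: "{r, j} \<in> g"
    then have "r \<noteq> j" using net network_no_loop by fastforce
    have "Refuse = due_favor (soiled h j r)"
      using f that \<open>r \<noteq> j\<close>
      by (auto simp: set_favor_stage favor_choice_grim_0 soiled_obs_private_hist split: option.splits)
    then have "soiled h r j" by (auto simp: due_favor_def soiled_commute split: if_splits)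
    then show False using assms(1) that rj by (auto simp: intact_elsewhere_def)
  qed
  then show ?thesis
    unfolding x by (intro intact_elsewhere_snoc[OF assms(1) l'(1,2)]) auto
qed

lemma deviation_link_value_le:
  assumes "intact_elsewhere g i h"
  shows "link_value P g ((grim 0)(i := s)) i h \<le> potential P B g i h"
proof -
  obtain C where "\<And>h. \<bar>potential P B g i h\<bar> \<le> C" using potential_bounded by blast
  then show ?thesis
    by (rule link_value_le[where I = "intact_elsewhere g i", OF valid])
      (use assms deviation_preserves_intact deviation_step in \<open>auto simp del: fun_upd_apply\<close>)
qed

lemma grim_link_value:
  assumes "intact_elsewhere g i h"
  shows "link_value P g (grim 0) i h = potential P B g i h"
proof (rule antisym)
  show "link_value P g (grim 0) i h \<le> potential P B g i h"
    using deviation_link_value_le[OF assms, of "grim 0 i"] by simp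
  obtain C where C: "\<And>h. \<bar>potential P B g i h\<bar> \<le> C" using potential_bounded by blast
  have "intact_elsewhere g i (h @ [x])"
    if "intact_elsewhere g i h" "x \<in> set_pmf (play_period P (grim 0) g h)" for h x
    using deviation_preserves_intact[of i h x "grim 0 i"] that by simp
  with C show "potential P B g i h \<le> link_value P g (grim 0) i h"
    by (rule link_value_ge[where I = "intact_elsewhere g i", OF valid])
      (use assms grim_step in auto)
qed

text \<open>Since \<open>i\<close> takes part in the favor, the history stays intact elsewhere
  whatever she answers. Hence the potential bounds the continuation after a deviation and equals it
  under grim trigger, and only her answer remains to be compared.\<close>

lemma deviation_favor_value_le:
  assumes "intact_elsewhere g i h" "legal (current_net g h) l" "quiet i h l" "{i, r} \<in> kept l"
  shows "favor_value P g ((grim 0)(i := s)) i (h, l, Some (r, i))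
    \<le> favor_value P g (grim 0) i (h, l, Some (r, i))"
proof -
  have "r \<noteq> i"
    using assms(4) kept_subset_net[OF assms(1,2)] net network_no_loop by fastforce
  have intact: "intact_elsewhere g i (h @ [(l, Some (r, i, a))])" for a
    by (rule intact_elsewhere_snoc[OF assms(1-3)]) auto
  let ?F = "future i h l (Some (r, i, due_favor (soiled h i r)))"
  have "favor_value P g (grim 0) i (h, l, Some (r, i)) = ?F"
    using \<open>r \<noteq> i\<close> grim_link_value[OF intact]
    by (simp add: favor_stage_def favor_choice_grim_0 soiled_obs_private_hist future_def)
  moreover have "favor_value P g ((grim 0)(i := s)) i (h, l, Some (r, i)) \<le> ?F"
    unfolding favor_value.simps
  proof (rule expectation_le_const)
    fix f assume "f \<in> set_pmf (favor_stage ((grim 0)(i := s)) h l (Some (r, i)))"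
    then obtain a where f: "f = Some (r, i, a)" by (auto simp: set_favor_stage)
    have "disc P * link_value P g ((grim 0)(i := s)) i (h @ [(l, f)])
      \<le> disc P * potential P B g i (h @ [(l, f)])"
      unfolding f using disc by (intro mult_left_mono deviation_link_value_le intact) auto
    then have "favor_payoff P i f + disc P * link_value P g ((grim 0)(i := s)) i (h @ [(l, f)])
      \<le> future i h l f" by (simp add: future_def)
    also have "\<dots> \<le> ?F" unfolding f by (rule due_favor_optimal(1)[OF assms(1,2,4)])
    finally show "favor_payoff P i f + disc P * link_value P g ((grim 0)(i := s)) i (h @ [(l, f)]) \<le> ?F" .
  qed simp
  ultimately show ?thesis by simp
qed

end


section \<open>Consistent beliefs\<close>

text \<open>The shift by \<open>2\<close> keeps the error probability strictly between
  \<open>0\<close> and \<open>1\<close>, so that every perturbed choice is fully mixed.\<close>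

definition eps :: "nat \<Rightarrow> real" where
  "eps m = 1 / (real m + 2)"

lemma eps_bounds: "0 < eps m" "eps m < 1"
  by (auto simp: eps_def)

lemma eps_tendsto_0: "eps \<longlonglongrightarrow> 0"
  using LIMSEQ_ignore_initial_segment[OF lim_1_over_n[where 'a = real], of 2]
  by (simp add: eps_def[abs_def] add.commute)

text \<open>The positive limit makes \<open>e\<close> the exact order in \<open>eps\<close>: orders
  add under products, and smaller orders dominate in quotients.\<close>

definition vanishing_order :: "(nat \<Rightarrow> real) \<Rightarrow> nat \<Rightarrow> bool" where
  "vanishing_order w e \<longleftrightarrow> (\<exists>c>0. (\<lambda>m. w m / eps m ^ e) \<longlonglongrightarrow> c)"

lemma vanishing_order_const: "0 < c \<Longrightarrow> vanishing_order (\<lambda>_. c) 0"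
  unfolding vanishing_order_def by auto

lemma vanishing_order_mult:
  assumes "vanishing_order w e" "vanishing_order w' e'"
  shows "vanishing_order (\<lambda>m. w m * w' m) (e + e')"
proof -
  obtain c c' where "0 < c" "0 < c'" "(\<lambda>m. w m / eps m ^ e) \<longlonglongrightarrow> c" "(\<lambda>m. w' m / eps m ^ e') \<longlonglongrightarrow> c'"
    using assms by (auto simp: vanishing_order_def)
  then have "(\<lambda>m. (w m / eps m ^ e) * (w' m / eps m ^ e')) \<longlonglongrightarrow> c * c'"
    by (intro tendsto_mult)
  moreover have "0 < c * c'" using \<open>0 < c\<close> \<open>0 < c'\<close> by simp
  ultimately show ?thesis
    unfolding vanishing_order_def power_add by (intro exI[of _ "c * c'"]) simp
qed

lemma vanishing_order_prod:
  assumes "finite A" "\<And>x. x \<in> A \<Longrightarrow> vanishing_order (\<lambda>m. w m x) (e x)"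
  shows "vanishing_order (\<lambda>m. \<Prod>x\<in>A. w m x) (\<Sum>x\<in>A. e x)"
  using assms
  by (induction A rule: finite_induct) (auto intro: vanishing_order_const vanishing_order_mult)

lemma vanishing_order_choice:
  "vanishing_order (\<lambda>m. if b then 1 - eps m else eps m) (if b then 0 else 1)"
proof -
  have "(\<lambda>m. 1 - eps m) \<longlonglongrightarrow> 1 - 0" by (intro tendsto_diff tendsto_const eps_tendsto_0)
  moreover have "eps m / eps m = 1" for m using eps_bounds[of m] by simp
  ultimately show ?thesis
    unfolding vanishing_order_def by (intro exI[of _ 1]) (cases b; simp)
qed

lemma vanishing_order_eventually_pos:
  assumes "vanishing_order w e"
  shows "eventually (\<lambda>m. 0 < w m) sequentially"
proof -
  obtain c where "0 < c" "(\<lambda>m. w m / eps m ^ e) \<longlonglongrightarrow> c"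
    using assms by (auto simp: vanishing_order_def)
  then have "eventually (\<lambda>m. 0 < w m / eps m ^ e) sequentially"
    by (auto dest: order_tendstoD)
  then show ?thesis
    by (rule eventually_mono) (metis eps_bounds(1) less_asym zero_less_divide_iff zero_less_power)
qed

text \<open>Dividing numerator and denominator of the conditional probability by \<open>eps\<close>
  to the least order in \<open>S\<close> makes both converge. Only elements of least order retain
  mass, in proportion to their leading coefficients.\<close>

lemma limit_of_conditionals:
  fixes p :: "nat \<Rightarrow> 'b pmf"
  assumes "finite S" "S \<noteq> {}" and order: "\<And>x. x \<in> S \<Longrightarrow> vanishing_order (\<lambda>m. pmf (p m) x) (e x)"
  shows "\<exists>b. (\<forall>x. (\<lambda>m. pmf (cond_pmf (p m) S) x) \<longlonglongrightarrow> pmf b x)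
    \<and> set_pmf b \<subseteq> {x\<in>S. \<forall>y\<in>S. e x \<le> e y}"
proof -
  obtain c where c: "\<And>x. x \<in> S \<Longrightarrow> 0 < c x"
    and lim: "\<And>x. x \<in> S \<Longrightarrow> (\<lambda>m. pmf (p m) x / eps m ^ e x) \<longlonglongrightarrow> c x"
    using order unfolding vanishing_order_def by metis
  define e0 where "e0 = Min (e ` S)"
  define c' where "c' x = (if x \<in> S \<and> e x = e0 then c x else 0)" for x
  define b where "b x = c' x / sum c' S" for x
  have e0: "e0 \<le> e x" if "x \<in> S" for x using that assms(1) by (simp add: e0_def)
  have c'_nonneg: "0 \<le> c' x" for x using c by (auto simp: c'_def intro: less_imp_le)
  have pos: "0 < sum c' S"
  proof -
    have "e0 \<in> e ` S" unfolding e0_def using assms by (intro Min_in) auto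
    then obtain x where "x \<in> S" "0 < c' x" using c by (auto simp: c'_def)
    then show ?thesis using assms(1) c'_nonneg by (intro sum_pos2[of S x]) auto
  qed
  have lim': "(\<lambda>m. pmf (p m) x / eps m ^ e0) \<longlonglongrightarrow> c' x" if "x \<in> S" for x
  proof -
    \<comment> \<open>This limit is \<open>1\<close> if \<open>x\<close> has the least order and
      \<open>0\<close> otherwise, which is the selection made by \<open>c'\<close>.\<close>
    have "(\<lambda>m. eps m ^ (e x - e0)) \<longlonglongrightarrow> 0 ^ (e x - e0)"
      by (intro tendsto_power eps_tendsto_0)
    then have "(\<lambda>m. pmf (p m) x / eps m ^ e x * eps m ^ (e x - e0)) \<longlonglongrightarrow> c x * 0 ^ (e x - e0)"
      using lim[OF that] by (intro tendsto_mult)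
    moreover have "pmf (p m) x / eps m ^ e x * eps m ^ (e x - e0) = pmf (p m) x / eps m ^ e0" for m
      using eps_bounds[of m] e0[OF that] by (simp add: power_diff)
    moreover have "c x * 0 ^ (e x - e0) = c' x"
      using e0[OF that] that by (cases "e x = e0") (auto simp: c'_def)
    ultimately show ?thesis by simp
  qed
  have pmf_b: "pmf (embed_pmf b) x = b x" for x
  proof (rule pmf_embed_pmf)
    show nn: "0 \<le> b x" for x using pos c'_nonneg by (simp add: b_def)
    have "(\<integral>\<^sup>+ x. ennreal (b x) \<partial>count_space UNIV) = (\<Sum>x\<in>S. ennreal (b x))"
      using assms(1) by (intro nn_integral_count_space') (auto simp: b_def c'_def)
    also have "\<dots> = ennreal (sum b S)" using nn by (simp add: sum_ennreal)
    also have "sum b S = 1" using pos by (simp add: b_def sum_divide_distrib[symmetric])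
    finally show "(\<integral>\<^sup>+ x. ennreal (b x) \<partial>count_space UNIV) = 1" by simp
  qed
  have "(\<lambda>m. pmf (cond_pmf (p m) S) x) \<longlonglongrightarrow> b x" for x
  proof -
    obtain x0 where x0: "x0 \<in> S" using assms(2) by blast
    \<comment> \<open>\<open>cond_pmf\<close> has its meaning only where the conditioning event has
      positive probability.\<close>
    have ev: "eventually (\<lambda>m. set_pmf (p m) \<inter> S \<noteq> {}) sequentially"
      using vanishing_order_eventually_pos[OF order[OF x0]]
      by eventually_elim (metis IntI empty_iff less_irrefl set_pmf_iff x0)
    show ?thesis
    proof (cases "x \<in> S")
      case True
      have "(\<lambda>m. (pmf (p m) x / eps m ^ e0) / (\<Sum>y\<in>S. pmf (p m) y / eps m ^ e0))
        \<longlonglongrightarrow> c' x / sum c' S"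
        using pos by (intro tendsto_divide tendsto_sum lim' True) auto
      moreover have "eventually (\<lambda>m. (pmf (p m) x / eps m ^ e0) / (\<Sum>y\<in>S. pmf (p m) y / eps m ^ e0)
        = pmf (cond_pmf (p m) S) x) sequentially"
        using ev
      proof eventually_elim
        case (elim m)
        have "eps m ^ e0 \<noteq> 0" using eps_bounds[of m] by simp
        then show ?case
          using elim True assms(1)
          by (simp add: pmf_cond measure_measure_pmf_finite sum_divide_distrib[symmetric])
      qed
      ultimately show ?thesis
        unfolding b_def by (rule Lim_transform_eventually)
    next
      case False
      have "eventually (\<lambda>m. 0 = pmf (cond_pmf (p m) S) x) sequentially"
        using ev by eventually_elim (simp add: pmf_cond False)
      then have "(\<lambda>m. pmf (cond_pmf (p m) S) x) \<longlonglongrightarrow> 0"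
        by (rule Lim_transform_eventually[OF tendsto_const])
      then show ?thesis using False by (simp add: b_def c'_def)
    qed
  qed
  moreover have "set_pmf (embed_pmf b) \<subseteq> {x\<in>S. \<forall>y\<in>S. e x \<le> e y}"
    using e0 by (auto simp: set_pmf_iff pmf_b b_def c'_def split: if_splits)
  ultimately show ?thesis using pmf_b by (intro exI[of _ "embed_pmf b"]) simp
qed

section \<open>Feasible histories and the order of their probabilities\<close>

inductive feasible :: "'a network \<Rightarrow> 'a history \<Rightarrow> bool" for g where
  Nil: "feasible g []"
| snoc: "feasible g h \<Longrightarrow> legal (current_net g h) l
    \<Longrightarrow> (\<And>r s a. f = Some (r, s, a) \<Longrightarrow> {r, s} \<in> kept l) \<Longrightarrow> feasible g (h @ [(l, f)])"

definition link_trembles :: "'a history \<Rightarrow> 'a link_profile \<Rightarrow> ('a \<times> 'a) set" where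
  "link_trembles h l = {(j, k). \<exists>a. l (j, k) = Some a \<and> a \<noteq> due_link (soiled h j k)}"

definition favor_trembles :: "'a history \<Rightarrow> 'a favor \<Rightarrow> nat" where
  "favor_trembles h f = (case f of None \<Rightarrow> 0
     | Some (r, s, a) \<Rightarrow> if a = due_favor (soiled h r s) then 0 else 1)"

text \<open>The number of errors that grim trigger needs to produce \<open>h\<close>. Each action is
  judged by the refusals before its period, hence \<open>take t h\<close>.\<close>

definition trembles :: "'a history \<Rightarrow> nat" where
  "trembles h = (\<Sum>t<length h. card (link_trembles (take t h) (fst (h ! t)))
     + favor_trembles (take t h) (snd (h ! t)))"

lemma trembles_Nil [simp]: "trembles [] = 0"
  by (simp add: trembles_def)

lemma trembles_snoc [simp]:
  "trembles (h @ [(l, f)]) = trembles h + (card (link_trembles h l) + favor_trembles h f)"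
  by (simp add: trembles_def nth_append)

lemma feasible_subset: "feasible g h \<Longrightarrow> current_net g h \<subseteq> g"
  by (induction rule: feasible.induct) (auto dest: kept_subset)

text \<open>Histories record the outcome of every stage, so only one intermediate value leads to a
  given history and its probability is a plain product.\<close>

lemma pmf_bind_single:
  assumes "\<And>x. x \<in> set_pmf p \<Longrightarrow> x \<noteq> x0 \<Longrightarrow> y \<notin> set_pmf (f x)"
  shows "pmf (p \<bind> f) y = pmf p x0 * pmf (f x0) y"
  unfolding pmf_bind
  by (subst integral_measure_pmf[of "{x0}"]) (use assms in \<open>auto simp: pmf_eq_0_set_pmf\<close>)

lemma pmf_play_snoc:
  "pmf (play P \<sigma> g h0 (Suc k)) (h @ [x]) = pmf (play P \<sigma> g h0 k) h * pmf (play_period P \<sigma> g h) x"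
proof -
  have "pmf (play_period P \<sigma> g h \<bind> (\<lambda>x. return_pmf (h @ [x]))) (h @ [x])
    = pmf (play_period P \<sigma> g h) x"
    by (subst pmf_bind_single[of _ x]) auto
  then show ?thesis
    unfolding play.simps by (subst pmf_bind_single[of _ h]) auto
qed

lemma favor_stage_query:
  "f \<in> set_pmf (favor_stage \<sigma> h l q) \<Longrightarrow> q = map_option (\<lambda>(r, s, a). (r, s)) f"
  by (auto simp: set_favor_stage split: option.splits)

lemma pmf_play_period:
  fixes g :: "'a :: finite network"
  shows "pmf (play_period P \<sigma> g h) (l, f) = pmf (link_stage \<sigma> g h) l * (case f of
     None \<Rightarrow> pmf (match_stage P (kept l)) None
   | Some (r, s, a) \<Rightarrow> pmf (match_stage P (kept l)) (Some (r, s))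
       * pmf (favor_choice (\<sigma> s) (private_hist s h) (link_obs s l) r) a)"
proof -
  \<comment> \<open>The only matching outcome compatible with the recorded favor.\<close>
  define q where "q = map_option (\<lambda>(r, s, a). (r, s)) f"
  have "pmf (favor_stage \<sigma> h l q \<bind> (\<lambda>f. return_pmf (l, f))) (l, f) = pmf (favor_stage \<sigma> h l q) f"
    by (subst pmf_bind_single[of _ f]) auto
  moreover have "pmf (match_stage P (kept l) \<bind> (\<lambda>q. favor_stage \<sigma> h l q \<bind> (\<lambda>f. return_pmf (l, f)))) (l, f)
    = pmf (match_stage P (kept l)) q * pmf (favor_stage \<sigma> h l q \<bind> (\<lambda>f. return_pmf (l, f))) (l, f)"
    by (rule pmf_bind_single) (auto simp: q_def dest: favor_stage_query)
  moreover have "pmf (play_period P \<sigma> g h) (l, f) = pmf (link_stage \<sigma> g h) l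
    * pmf (match_stage P (kept l) \<bind> (\<lambda>q. favor_stage \<sigma> h l q \<bind> (\<lambda>f. return_pmf (l, f)))) (l, f)"
    unfolding play_period_def by (rule pmf_bind_single) auto
  ultimately have "pmf (play_period P \<sigma> g h) (l, f)
    = pmf (link_stage \<sigma> g h) l * (pmf (match_stage P (kept l)) q * pmf (favor_stage \<sigma> h l q) f)"
    by simp
  also have "pmf (match_stage P (kept l)) q * pmf (favor_stage \<sigma> h l q) f = (case f of
     None \<Rightarrow> pmf (match_stage P (kept l)) None
   | Some (r, s, a) \<Rightarrow> pmf (match_stage P (kept l)) (Some (r, s))
       * pmf (favor_choice (\<sigma> s) (private_hist s h) (link_obs s l) r) a)"
  proof (cases f)
    case (Some z)
    obtain r s a where z: "z = (r, s, a)" by (cases z)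
    have "pmf (map_pmf (\<lambda>a. Some (r, s, a)) M) (Some (r, s, a)) = pmf M a" for M :: "favor_act pmf"
      by (rule pmf_map_inj') (simp add: inj_def)
    then show ?thesis by (simp add: q_def Some z favor_stage_def)
  qed (simp add: q_def favor_stage_def)
  finally show ?thesis .
qed

lemma pmf_play_to_favor:
  "pmf (play_to_favor P \<sigma> g t) (h, l, q)
    = pmf (play P \<sigma> g [] t) h * (pmf (link_stage \<sigma> g h) l * pmf (match_stage P (kept l)) q)"
  unfolding play_to_favor_def
  by (subst pmf_bind_single[of _ h], force, subst pmf_bind_single[of _ l], force,
      subst pmf_bind_single[of _ q]) auto

text \<open>The decisions are independent; a due one contributes \<open>1 - eps m\<close>, of order
  \<open>0\<close>, and an error contributes \<open>eps m\<close>, of order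
  \<open>1\<close>.\<close>

lemma link_stage_order:
  fixes g :: "'a :: finite network"
  assumes "network g" "current_net g h \<subseteq> g" "legal (current_net g h) l"
  shows "vanishing_order (\<lambda>m. pmf (link_stage (grim (eps m)) g h) l) (card (link_trembles h l))"
proof -
  let ?D = "{(j, k). {j, k} \<in> current_net g h}"
  let ?due = "\<lambda>x. l x = Some (due_link (soiled h (fst x) (snd x)))"
  have out: "l x = None" if "x \<notin> ?D" for x
    using that assms(3) by (cases x; cases "l x") (auto simp: legal_def)
  have inj: "pmf (map_pmf Some M) (Some a) = pmf M a" for M :: "link_act pmf" and a
    by (rule pmf_map_inj') (simp add: inj_def)
  have factor: "pmf ((\<lambda>(j, k). map_pmf Some (link_choice (grim (eps m) j) (private_hist j h) k)) x) (l x)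
    = (if ?due x then 1 - eps m else eps m)" if "x \<in> ?D" for x m
  proof -
    obtain j k where x: "x = (j, k)" by (cases x)
    have "j \<noteq> k" using that x assms(1,2) network_no_loop by fastforce
    have "l (j, k) \<noteq> None" using that x assms(3) by (simp add: legal_def)
    then obtain a where a: "l (j, k) = Some a" by blast
    show ?thesis
      using \<open>j \<noteq> k\<close> eps_bounds[of m]
      by (simp add: x a inj pmf_link_choice_grim soiled_obs_private_hist)
  qed
  have "pmf (link_stage (grim (eps m)) g h) l = (\<Prod>x\<in>?D. if ?due x then 1 - eps m else eps m)" for m
    unfolding link_stage_def
    by (subst pmf_Pi')
      (auto intro!: out prod.cong simp: factor[simplified] simp del: split_paired_All)
  moreover have "card (link_trembles h l) = (\<Sum>x\<in>?D. if ?due x then 0 else 1)"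
  proof -
    have "link_trembles h l = {x\<in>?D. \<not> ?due x}"
      using assms(3) by (fastforce simp: link_trembles_def legal_def)
    then show ?thesis by (simp add: sum.If_cases Int_def)
  qed
  ultimately show ?thesis
    by (simp only:) (intro vanishing_order_prod vanishing_order_choice finite)
qed

context
  fixes P :: params and g :: "'a :: finite network"
  assumes valid: "valid_params P" and few: "real CARD('a) * alpha P \<le> 1" and net: "network g"
begin

text \<open>Matching contributes constants that are positive at feasible histories, so the order
  counts the errors of the players only.\<close>

lemma play_order:
  assumes "feasible g h"
  shows "vanishing_order (\<lambda>m. pmf (play P (grim (eps m)) g [] (length h)) h) (trembles h)"
  using assms
proof (induction rule: feasible.induct)
  case Nil
  then show ?case by (simp add: vanishing_order_const)
next
  case (snoc h l f)
  have sub: "kept l \<subseteq> g" using snoc feasible_subset[of g h] kept_subset by blast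
  have "vanishing_order (\<lambda>m. case f of
     None \<Rightarrow> pmf (match_stage P (kept l)) None
   | Some (r, s, a) \<Rightarrow> pmf (match_stage P (kept l)) (Some (r, s))
       * pmf (favor_choice (grim (eps m) s) (private_hist s h) (link_obs s l) r) a) (favor_trembles h f)"
  proof (cases f)
    case None
    then show ?thesis
      using pmf_match_stage_None_pos[OF valid few, of "kept l"]
      by (simp add: favor_trembles_def vanishing_order_const)
  next
    case (Some z)
    obtain r s a where z: "z = (r, s, a)" by (cases z)
    then have rs: "{r, s} \<in> kept l" using snoc Some by blast
    then have "r \<noteq> s" using sub net network_no_loop by fastforce
    have "0 < pmf (match_stage P (kept l)) (Some (r, s))"
      using rs by (simp add: pmf_match_stage_pos_iff[OF valid few] nbrs_def)
    then have "vanishing_order (\<lambda>m. pmf (match_stage P (kept l)) (Some (r, s))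
        * (if a = due_favor (soiled h r s) then 1 - eps m else eps m))
      (0 + (if a = due_favor (soiled h r s) then 0 else 1))"
      by (intro vanishing_order_mult vanishing_order_const vanishing_order_choice)
    then show ?thesis
      using \<open>r \<noteq> s\<close> eps_bounds
      by (simp add: Some z favor_trembles_def pmf_favor_choice_grim less_imp_le
          soiled_obs_private_hist soiled_commute[of h s r])
  qed
  then show ?case
    unfolding length_append_singleton pmf_play_snoc pmf_play_period trembles_snoc
    using snoc by (intro vanishing_order_mult link_stage_order net feasible_subset)
qed

text \<open>The final \<open>0\<close> is the order of the matching probability; the favor itself is
  not yet decided.\<close>

lemma play_to_favor_order:
  assumes "feasible g h" "legal (current_net g h) l" "{r, s} \<in> kept l"
  shows "vanishing_order (\<lambda>m. pmf (play_to_favor P (grim (eps m)) g (length h)) (h, l, Some (r, s)))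
    (trembles h + (card (link_trembles h l) + 0))"
proof -
  have "0 < pmf (match_stage P (kept l)) (Some (r, s))"
    using assms(3) by (simp add: pmf_match_stage_pos_iff[OF valid few] nbrs_def)
  then show ?thesis
    unfolding pmf_play_to_favor using assms
    by (intro vanishing_order_mult play_order link_stage_order net feasible_subset
        vanishing_order_const)
qed

lemma match_stage_link:
  assumes "Some (r, s) \<in> set_pmf (match_stage P G)"
  shows "{r, s} \<in> (G :: 'a network)"
  using assms pmf_positive[OF assms] by (simp add: pmf_match_stage_pos_iff[OF valid few] nbrs_def)

lemma play_feasible: "h \<in> set_pmf (play P \<sigma> g [] k) \<Longrightarrow> feasible g h"
proof (induction k arbitrary: h)
  case 0
  then show ?case by (simp add: feasible.Nil)
next
  case (Suc k)
  then obtain h' l q f where h: "h = h' @ [(l, f)]" and "feasible g h'"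
    and "l \<in> set_pmf (link_stage \<sigma> g h')" and q: "q \<in> set_pmf (match_stage P (kept l))"
    and f: "f \<in> set_pmf (favor_stage \<sigma> h' l q)"
    by (auto simp: play_period_def)
  moreover have "{r, s} \<in> kept l" if "f = Some (r, s, a)" for r s a
  proof -
    have "q = Some (r, s)" using f that by (auto simp: set_favor_stage split: option.splits)
    then show ?thesis using q match_stage_link by blast
  qed
  ultimately show ?case
    unfolding h by (intro feasible.snoc) (auto simp: set_link_stage)
qed

text \<open>A feasible history has positive probability under a perturbed grim trigger, so
  reachability under some profile becomes a combinatorial condition.\<close>

lemma link_info_eq: "link_info P g i hi = {h. private_hist i h = hi \<and> feasible g h}"
proof -
  have "\<exists>\<sigma>. h \<in> set_pmf (play P \<sigma> g [] (length h))" if feas: "feasible g h" for h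
  proof -
    obtain m where "0 < pmf (play P (grim (eps m)) g [] (length h)) h"
      using vanishing_order_eventually_pos[OF play_order[OF feas]]
      by (auto simp: eventually_sequentially)
    then show ?thesis by (metis less_irrefl set_pmf_iff)
  qed
  moreover have "length h = length hi" if "private_hist i h = hi" for h
    using that by (auto simp: private_hist_def)
  ultimately show ?thesis
    unfolding link_info_def using play_feasible by fastforce
qed

lemma favor_info_eq: "favor_info P g i hi li r
  = {(h, l, q). private_hist i h = hi \<and> link_obs i l = li \<and> q = Some (r, i)
      \<and> feasible g h \<and> legal (current_net g h) l \<and> {r, i} \<in> kept l}"
proof -
  have 1: "\<exists>\<sigma>. (h, l, Some (r, i)) \<in> set_pmf (play_to_favor P \<sigma> g (length h))"
    if node: "feasible g h" "legal (current_net g h) l" "{r, i} \<in> kept l" for h l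
  proof -
    obtain m where "0 < pmf (play_to_favor P (grim (eps m)) g (length h)) (h, l, Some (r, i))"
      using vanishing_order_eventually_pos[OF play_to_favor_order[OF node]]
      by (auto simp: eventually_sequentially)
    then show ?thesis by (metis less_irrefl set_pmf_iff)
  qed
  have 2: "feasible g h \<and> legal (current_net g h) l \<and> {r, i} \<in> kept l"
    if "(h, l, Some (r, i)) \<in> set_pmf (play_to_favor P \<sigma> g t)" for h l \<sigma> t
    using that play_feasible match_stage_link
    by (auto simp: play_to_favor_def set_link_stage)
  have len: "length h = length hi" if "private_hist i h = hi" for h
    using that by (auto simp: private_hist_def)
  show ?thesis
    unfolding favor_info_def using 1 2 len by fastforce
qed

end

section \<open>Explaining an observation without errors elsewhere\<close>

definition idealize_links :: "'a network \<Rightarrow> 'a \<Rightarrow> 'a link_profile \<Rightarrow> 'a link_profile" where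
  "idealize_links g i l = (\<lambda>(j, k). if j = i \<or> k = i then l (j, k)
     else if {j, k} \<in> g then Some Keep else None)"

text \<open>What \<open>i\<close> observed in \<open>h\<close>, explained without any deviation between two other players. Replacing
  a favor between others by no favor is always feasible: possibly nobody was able to provide it.\<close>

definition idealize :: "'a network \<Rightarrow> 'a \<Rightarrow> 'a history \<Rightarrow> 'a history" where
  "idealize g i h = map (\<lambda>(l, f). (idealize_links g i l, favor_obs i f)) h"

lemma idealize_Nil [simp]: "idealize g i [] = []"
  by (simp add: idealize_def)

lemma idealize_snoc [simp]:
  "idealize g i (h @ [(l, f)]) = idealize g i h @ [(idealize_links g i l, favor_obs i f)]"
  by (simp add: idealize_def)

lemma link_obs_idealize [simp]: "link_obs i (idealize_links g i l) = link_obs i l"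
  by (simp add: link_obs_def idealize_links_def)

lemma favor_obs_idem [simp]: "favor_obs i (favor_obs i f) = favor_obs i f"
  by (auto simp: favor_obs_def split: option.splits)

lemma favor_obs_Some_iff:
  "favor_obs i f = Some (r, s, a) \<longleftrightarrow> f = Some (r, s, a) \<and> (i = r \<or> i = s)"
  by (auto simp: favor_obs_def split: option.splits if_splits)

lemma private_hist_idealize [simp]: "private_hist i (idealize g i h) = private_hist i h"
  by (simp add: private_hist_def idealize_def case_prod_beta)

lemma kept_idealize:
  "{j, k} \<in> kept (idealize_links g i l) \<longleftrightarrow> (if j = i \<or> k = i then {j, k} \<in> kept l else {j, k} \<in> g)"
  by (auto simp: kept_iff idealize_links_def insert_commute)

lemma current_net_idealize:
  "{j, k} \<in> current_net g (idealize g i h)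
    \<longleftrightarrow> (if j = i \<or> k = i then {j, k} \<in> current_net g h else {j, k} \<in> g)"
proof (cases h rule: rev_cases)
  case (snoc h' x)
  then show ?thesis by (cases x) (simp add: kept_idealize)
qed simp

lemma soiled_idealize: "soiled (idealize g i h) j k \<longleftrightarrow> soiled h j k \<and> (j = i \<or> k = i)"
  by (induction h rule: rev_induct) (auto simp: favor_obs_Some_iff)

lemma legal_idealize:
  assumes "legal (current_net g h) l"
  shows "legal (current_net g (idealize g i h)) (idealize_links g i l)"
  using assms by (auto simp: legal_def current_net_idealize idealize_links_def)

text \<open>The favors that survive involve \<open>i\<close>, and her own links are the same in both
  histories.\<close>

lemma feasible_idealize: "feasible g h \<Longrightarrow> feasible g (idealize g i h)"
proof (induction rule: feasible.induct)
  case (snoc h l f)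
  then show ?case
    unfolding idealize_snoc
    by (intro feasible.snoc legal_idealize) (auto simp: favor_obs_Some_iff kept_idealize)
qed (simp add: feasible.Nil)

text \<open>In the idealized history links between others are never soiled, so the decisions to keep
  them are due; whether a link of \<open>i\<close> is soiled does not change.\<close>

lemma link_trembles_idealize:
  assumes "network g"
  shows "link_trembles (idealize g i h) (idealize_links g i l)
    = {x\<in>link_trembles h l. fst x = i \<or> snd x = i}"
  unfolding link_trembles_def
  by (auto simp: idealize_links_def soiled_idealize due_link_def split: if_splits)

lemma favor_trembles_idealize:
  "favor_trembles (idealize g i h) (favor_obs i f) = favor_trembles h (favor_obs i f)"
  by (auto simp: favor_trembles_def favor_obs_def soiled_idealize split: option.split)

lemma favor_trembles_obs_le: "favor_trembles h (favor_obs i f) \<le> favor_trembles h f"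
  by (auto simp: favor_trembles_def favor_obs_def split: option.split)

lemma card_link_trembles_idealize_le:
  fixes g :: "'a :: finite network"
  assumes "network g"
  shows "card (link_trembles (idealize g i h) (idealize_links g i l)) \<le> card (link_trembles h l)"
  unfolding link_trembles_idealize[OF assms] by (intro card_mono) auto

text \<open>Idealizing only discards errors between others; if the count does not drop, there were
  none.\<close>

lemma quiet_if_fewest_trembles:
  fixes g :: "'a :: finite network"
  assumes "network g"
    and "card (link_trembles h l) \<le> card (link_trembles (idealize g i h) (idealize_links g i l))"
  shows "quiet i h l"
proof -
  have "{x\<in>link_trembles h l. fst x = i \<or> snd x = i} = link_trembles h l"
    using assms unfolding link_trembles_idealize[OF assms(1)]
    by (intro card_seteq) auto
  then show ?thesis unfolding quiet_def link_trembles_def by fastforce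
qed

lemma trembles_idealize_le:
  fixes g :: "'a :: finite network"
  assumes "feasible g h" "network g"
  shows "trembles (idealize g i h) \<le> trembles h"
  using assms
proof (induction rule: feasible.induct)
  case (snoc h l f)
  then show ?case
    using card_link_trembles_idealize_le[of g i h l] favor_trembles_obs_le[of h i f]
    by (simp add: favor_trembles_idealize)
qed simp

text \<open>Idealizing adds no error at any stage. If it does not reduce the total, then no stage
  had an error between others, and by induction their links are intact.\<close>

lemma intact_if_fewest_trembles:
  fixes g :: "'a :: finite network"
  assumes "feasible g h" "network g" "trembles h \<le> trembles (idealize g i h)"
  shows "intact_elsewhere g i h"
  using assms
proof (induction rule: feasible.induct)
  case Nil
  then show ?case by (simp add: intact_elsewhere_def)
next
  case (snoc h l f)
  note le = trembles_idealize_le[OF snoc(1) snoc.prems(1), of i]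
    card_link_trembles_idealize_le[OF snoc.prems(1), of i h l] favor_trembles_obs_le[of h i f]
  \<comment> \<open>None of the three summands grows when idealized, so the inequality between the
    sums holds for each summand.\<close>
  have eq: "trembles h \<le> trembles (idealize g i h)"
    "card (link_trembles h l) \<le> card (link_trembles (idealize g i h) (idealize_links g i l))"
    "favor_trembles h f \<le> favor_trembles h (favor_obs i f)"
    using le snoc.prems(2) by (auto simp: favor_trembles_idealize)
  have intact: "intact_elsewhere g i h" using snoc.IH snoc.prems(1) eq(1) by blast
  have "{r, s} \<notin> g" if "f = Some (r, s, Refuse)" "r \<noteq> i" "s \<noteq> i" for r s
  proof
    assume "{r, s} \<in> g"
    \<comment> \<open>A refusal on a clean link between others would be an error that idealizing
      erases.\<close>
    then have "\<not> soiled h r s" using intact that by (auto simp: intact_elsewhere_def)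
    then show False
      using eq(3) that by (simp add: favor_trembles_def favor_obs_def due_favor_def)
  qed
  then show ?case
    by (intro intact_elsewhere_snoc intact snoc quiet_if_fewest_trembles[OF snoc.prems(1) eq(2)])
      auto
qed

section \<open>Finite information sets, the path of play and the perturbed profiles\<close>

lemma finite_link_info: "finite (link_info P g i hi)"
proof (rule finite_subset)
  show "link_info P g i hi \<subseteq> {h. set h \<subseteq> UNIV \<and> length h = length hi}"
    by (auto simp: link_info_def private_hist_def)
qed (rule finite_lists_length_eq, simp)

lemma finite_favor_info: "finite (favor_info P g i hi li r)"
proof (rule finite_subset)
  show "favor_info P g i hi li r \<subseteq> {h. set h \<subseteq> UNIV \<and> length h = length hi} \<times> UNIV \<times> UNIV"
    by (auto simp: favor_info_def private_hist_def)
qed (intro finite_cartesian_product finite_lists_length_eq finite)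

lemma soiled_obs_imp_refusal:
  assumes "soiled_obs j (private_hist i h)"
  shows "\<exists>(l, f)\<in>set h. \<exists>r s. f = Some (r, s, Refuse)"
  using assms by (force simp: soiled_obs_def private_hist_def favor_obs_Some_iff)

text \<open>As long as no favor has been refused, no player observes a refusal, and grim trigger
  then keeps every link and provides every favor.\<close>

lemma cooperative_path_grim: "cooperative_path P g (grim 0)"
proof -
  have "\<forall>(l, f)\<in>set h. (\<forall>i j. l (i, j) \<noteq> Some Remove) \<and> (\<forall>r s. f \<noteq> Some (r, s, Refuse))"
    if "h \<in> set_pmf (play P (grim 0) g [] t)" for h t
    using that
  proof (induction t arbitrary: h)
    case (Suc t)
    then obtain h' l q f where h: "h = h' @ [(l, f)]"
      and h': "h' \<in> set_pmf (play P (grim 0) g [] t)"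
      and l: "l \<in> set_pmf (link_stage (grim 0) g h')" and f: "f \<in> set_pmf (favor_stage (grim 0) h' l q)"
      by (auto simp: play_period_def)
    have clean: "\<not> soiled_obs j (private_hist i h')" for i j
      using Suc.IH[OF h'] soiled_obs_imp_refusal[of j i h'] by fastforce
    have "l (i, j) \<noteq> Some Remove" for i j
    proof
      assume "l (i, j) = Some Remove"
      then have "Remove \<in> set_pmf (link_choice (grim 0 i) (private_hist i h') j)"
        using l[unfolded set_link_stage] by blast
      then show False using clean by (simp add: link_choice_grim_0 due_link_def)
    qed
    moreover have "f \<noteq> Some (r, s, Refuse)" for r s
      using f clean
      by (auto simp: set_favor_stage favor_choice_grim_0 due_favor_def split: option.splits)
    ultimately show ?case unfolding h using Suc.IH[OF h'] by auto
  qed simp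
  then show ?thesis unfolding cooperative_path_def by blast
qed

lemma fully_mixed_grim: "fully_mixed (grim (eps m))"
  using eps_bounds[of m]
  by (auto simp: fully_mixed_def set_pmf_iff pmf_link_choice_grim pmf_favor_choice_grim)

lemma grim_tendsto: "profile_tendsto (\<lambda>m. grim (eps m)) (grim 0)"
proof -
  have "(\<lambda>m. 1 - eps m) \<longlonglongrightarrow> 1 - 0" by (intro tendsto_diff tendsto_const eps_tendsto_0)
  then show ?thesis
    using eps_bounds eps_tendsto_0
    by (auto simp: profile_tendsto_def pmf_link_choice_grim pmf_favor_choice_grim less_imp_le)
qed

section \<open>Limit beliefs and the equilibrium\<close>

context regular_game
begin

definition limit_link_belief :: "'a \<Rightarrow> 'a obs list \<Rightarrow> 'a history pmf \<Rightarrow> bool" where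
  "limit_link_belief i hi b \<longleftrightarrow>
     (\<forall>x. (\<lambda>m. pmf (cond_pmf (play P (grim (eps m)) g [] (length hi)) (link_info P g i hi)) x)
       \<longlonglongrightarrow> pmf b x)
     \<and> set_pmf b \<subseteq> {h. intact_elsewhere g i h} \<and> finite (set_pmf b)"

definition limit_favor_belief ::
    "'a \<Rightarrow> 'a obs list \<Rightarrow> 'a link_obs \<Rightarrow> 'a \<Rightarrow> 'a favor_node pmf \<Rightarrow> bool" where
  "limit_favor_belief i hi li r b \<longleftrightarrow>
     (\<forall>x. (\<lambda>m. pmf (cond_pmf (play_to_favor P (grim (eps m)) g (length hi))
        (favor_info P g i hi li r)) x) \<longlonglongrightarrow> pmf b x)
     \<and> set_pmf b \<subseteq> {(h, l, q). intact_elsewhere g i h \<and> legal (current_net g h) l \<and> quiet i h l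
        \<and> {i, r} \<in> kept l \<and> q = Some (r, i)}
     \<and> finite (set_pmf b)"

text \<open>The limit charges only histories with the fewest errors in the information set. The
  idealization of such a history lies in the same set, hence has no fewer errors, and so the history
  is intact elsewhere.\<close>

lemma link_belief_exists:
  assumes "link_info P g i hi \<noteq> {}"
  shows "\<exists>b. limit_link_belief i hi b"
proof -
  note info = link_info_eq[OF valid few net]
  have "vanishing_order (\<lambda>m. pmf (play P (grim (eps m)) g [] (length hi)) h) (trembles h)"
    if "h \<in> link_info P g i hi" for h
    using play_order[OF valid few net, of h] that by (auto simp: info private_hist_def)
  from limit_of_conditionals[OF finite_link_info assms this] obtain b
    where lim: "\<forall>x. (\<lambda>m. pmf (cond_pmf (play P (grim (eps m)) g [] (length hi)) (link_info P g i hi)) x)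
      \<longlonglongrightarrow> pmf b x"
      and sub: "set_pmf b \<subseteq> {x\<in>link_info P g i hi. \<forall>y\<in>link_info P g i hi. trembles x \<le> trembles y}"
    by blast
  have "intact_elsewhere g i h" if "h \<in> set_pmf b" for h
  proof -
    have h: "feasible g h" "private_hist i h = hi" "\<forall>y\<in>link_info P g i hi. trembles h \<le> trembles y"
      using that sub by (auto simp: info)
    then have "idealize g i h \<in> link_info P g i hi" by (simp add: info feasible_idealize)
    then show ?thesis using h net by (intro intact_if_fewest_trembles) auto
  qed
  moreover have "finite (set_pmf b)"
    using sub by (intro finite_subset[OF _ finite_link_info[of P g i hi]]) auto
  ultimately show ?thesis unfolding limit_link_belief_def using lim by blast
qed

lemma favor_belief_exists:
  assumes "favor_info P g i hi li r \<noteq> {}"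
  shows "\<exists>b. limit_favor_belief i hi li r b"
proof -
  note info = favor_info_eq[OF valid few net]
  let ?S = "favor_info P g i hi li r"
  let ?e = "\<lambda>(h, l, q). trembles h + (card (link_trembles h l) + 0)"
  have "vanishing_order (\<lambda>m. pmf (play_to_favor P (grim (eps m)) g (length hi)) x) (?e x)"
    if "x \<in> ?S" for x
    using play_to_favor_order[OF valid few net] that by (auto simp: info private_hist_def)
  from limit_of_conditionals[OF finite_favor_info assms this] obtain b
    where lim: "\<forall>x. (\<lambda>m. pmf (cond_pmf (play_to_favor P (grim (eps m)) g (length hi)) ?S) x)
      \<longlonglongrightarrow> pmf b x" and sub: "set_pmf b \<subseteq> {x\<in>?S. \<forall>y\<in>?S. ?e x \<le> ?e y}"
    by blast
  have "intact_elsewhere g i h \<and> legal (current_net g h) l \<and> quiet i h l \<and> {i, r} \<in> kept l \<and> q = Some (r, i)"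
    if "(h, l, q) \<in> set_pmf b" for h l q
  proof -
    have x: "(h, l, q) \<in> ?S" and least: "\<And>y. y \<in> ?S \<Longrightarrow> ?e (h, l, q) \<le> ?e y" using that sub by auto
    have h: "feasible g h" "private_hist i h = hi" "link_obs i l = li"
      and l: "legal (current_net g h) l" "{r, i} \<in> kept l" and q: "q = Some (r, i)"
      using x by (auto simp: info)
    then have "(idealize g i h, idealize_links g i l, q) \<in> ?S"
      by (simp add: info feasible_idealize legal_idealize kept_idealize)
    from least[OF this] have
      "trembles h + card (link_trembles h l)
        \<le> trembles (idealize g i h) + card (link_trembles (idealize g i h) (idealize_links g i l))"
      by simp
    \<comment> \<open>Neither count grows under idealization, so the inequality between the sums
      splits.\<close>
    then have "trembles h \<le> trembles (idealize g i h)"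
      "card (link_trembles h l) \<le> card (link_trembles (idealize g i h) (idealize_links g i l))"
      using trembles_idealize_le[OF h(1) net, of i] card_link_trembles_idealize_le[OF net, of i h l]
      by auto
    then show ?thesis
      using intact_if_fewest_trembles[OF h(1) net] quiet_if_fewest_trembles[OF net] l q
      by (auto simp: insert_commute)
  qed
  moreover have "finite (set_pmf b)"
    using sub by (intro finite_subset[OF _ finite_favor_info[of P g i hi li r]]) auto
  ultimately show ?thesis unfolding limit_favor_belief_def using lim by blast
qed

text \<open>Grim trigger is optimal at every single node in the support of the limit beliefs, so the
  comparison survives averaging.\<close>

lemma grim_sequential_equilibrium: "\<exists>\<mu>. sequential_equilibrium P g (grim 0) \<mu>"
proof -
  obtain LB where LB: "\<And>i hi. link_info P g i hi \<noteq> {} \<Longrightarrow> limit_link_belief i hi (LB i hi)"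
    using link_belief_exists by metis
  obtain FB where FB: "\<And>i hi li r. favor_info P g i hi li r \<noteq> {}
      \<Longrightarrow> limit_favor_belief i hi li r (FB i hi li r)"
    using favor_belief_exists by metis
  let ?\<mu> = "\<lparr>link_belief = LB, favor_belief = FB\<rparr>"
  have "consistent P g (grim 0) ?\<mu>"
    unfolding consistent_def beliefs.simps
  proof (intro exI[of _ "\<lambda>m. grim (eps m)"] conjI allI impI fully_mixed_grim grim_tendsto)
    fix i hi x assume "link_info P g i hi \<noteq> {}"
    from LB[OF this] show "(\<lambda>m. pmf (cond_pmf (play P (grim (eps m)) g [] (length hi))
        (link_info P g i hi)) x) \<longlonglongrightarrow> pmf (LB i hi) x"
      unfolding limit_link_belief_def by blast
  next
    fix i hi li r x assume "favor_info P g i hi li r \<noteq> {}"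
    from FB[OF this] show "(\<lambda>m. pmf (cond_pmf (play_to_favor P (grim (eps m)) g (length hi))
        (favor_info P g i hi li r)) x) \<longlonglongrightarrow> pmf (FB i hi li r) x"
      unfolding limit_favor_belief_def by blast
  qed
  moreover have "sequentially_rational P g (grim 0) ?\<mu>"
    unfolding sequentially_rational_def beliefs.simps
  proof (intro conjI allI impI)
    fix i hi s assume "link_info P g i hi \<noteq> {}"
    note b = LB[OF this, unfolded limit_link_belief_def]
    show "measure_pmf.expectation (LB i hi) (link_value P g ((grim 0)(i := s)) i)
      \<le> measure_pmf.expectation (LB i hi) (link_value P g (grim 0) i)"
    proof (rule expectation_mono_finite)
      fix h assume "h \<in> set_pmf (LB i hi)"
      then have "intact_elsewhere g i h" using b by blast
      then show "link_value P g ((grim 0)(i := s)) i h \<le> link_value P g (grim 0) i h"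
        by (simp only: grim_link_value deviation_link_value_le)
    qed (use b in blast)
  next
    fix i hi li r s assume "favor_info P g i hi li r \<noteq> {}"
    note b = FB[OF this, unfolded limit_favor_belief_def]
    show "measure_pmf.expectation (FB i hi li r) (favor_value P g ((grim 0)(i := s)) i)
      \<le> measure_pmf.expectation (FB i hi li r) (favor_value P g (grim 0) i)"
    proof (rule expectation_mono_finite)
      fix x assume "x \<in> set_pmf (FB i hi li r)"
      then obtain h l where "x = (h, l, Some (r, i))" "intact_elsewhere g i h"
        "legal (current_net g h) l" "quiet i h l" "{i, r} \<in> kept l" using b by blast
      then show "favor_value P g ((grim 0)(i := s)) i x \<le> favor_value P g (grim 0) i x"
        using deviation_favor_value_le by (simp only:)
    qed (use b in blast)
  qed
  ultimately show ?thesis unfolding sequential_equilibrium_def by blast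
qed

lemma stable: "stable P g"
  unfolding stable_def bilateral_equilibrium_def
  using bilaterally_measurable_grim grim_sequential_equilibrium cooperative_path_grim by blast

end

theorem theorem2:
  fixes P :: params and B :: nat
  assumes "valid_params P"
    and "real CARD('a::finite) * alpha P \<le> 1"
    and "cooperation_bound P B"
  shows "(\<forall>g :: 'a network. network g \<and> (\<forall>i. link_degree g i = B) \<longrightarrow> strongly_stable P g) \<and>
         (\<forall>(g :: 'a network) k. strongly_stable P g \<and> 0 < k \<and> k < B \<longrightarrow>
            card {i. link_degree g i = k} \<le> k + 1)"
proof (intro conjI allI impI)
  fix g :: "'a network"
  assume g: "network g \<and> (\<forall>i. link_degree g i = B)"
  then interpret regular_game P B g
    using assms by unfold_locales auto
  show "strongly_stable P g"
    unfolding strongly_stable_def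
    using stable net regular_net_no_violation[OF valid bound net regular] by blast
next
  fix g :: "'a network" and k
  assume "strongly_stable P g \<and> 0 < k \<and> k < B"
  then show "card {i. link_degree g i = k} \<le> k + 1"
    using strongly_stable_degree_count[OF assms(1,3)] by blast
qed

end
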